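(* Let $\nu=0$, $T>0$, and let $(\mathbf u_h,p_h):[0,T]\to V_h^{1,c}\times V_h^{2,c}$ ($\mathbf u_h$ being $C^1$ in time), with $\operatorname{div}(\mathbf u_h(0))=0$, be a solution of the conforming semi-discrete incompressible Navier--Stokes scheme (with $\nu=0$): for all $t$, $$\int_\Omega \frac{\partial \mathbf u_h}{\partial t}\cdot \mathbf v_h+\int_\Omega \mathbf u_h\cdot s_h(\mathbf u_h,\mathbf v_h)+\int_\Omega (\widetilde{\mathrm{grad}}_h\, p_h)\cdot \mathbf v_h=0\quad\forall\,\mathbf v_h\in V_h^{1,c},$$ $$\int_\Omega \mathbf u_h\cdot s_h(\mathbf u_h,\widetilde{\mathrm{grad}}_h\, q_h)+\int_\Omega \widetilde{\mathrm{grad}}_h\, p_h\cdot\widetilde{\mathrm{grad}}_h\, q_h=0\quad\forall\, q_h\in V_h^{2,c}.$$ Then the energy is preserved: $\frac{\partial}{\partial t}\int_\Omega\frac12|\mathbf u_h|^2=0$.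
   Context: Setting (dimension $d=2$). $\Omega$ is a two-dimensional domain with either periodic boundary conditions (a rectangle with opposite sides identified; all function spaces are spaces of periodic functions: $V^0=H^1(\Omega)$, $V^1=H(\mathrm{div};\Omega)$, $V^2=L^2(\Omega)$) or homogeneous boundary conditions on a bounded Lipschitz domain ($V^0=H^1_0(\Omega)$, $V^1=H_0(\mathrm{div};\Omega)$, $V^2=L^2(\Omega)$). For scalar $\omega$, $\operatorname{curl}\omega=(\partial_2\omega,-\partial_1\omega)$. Discrete spaces: $V_h^{\ell,c}\subset V^\ell$, $\ell=0,1,2$, are finite-dimensional (finite element) spaces of bounded functions with $\operatorname{curl}V_h^{0,c}\subset V_h^{1,c}$ and $\operatorname{div}V_h^{1,c}\subset V_h^{2,c}$ (and there are projections $\Pi_\ell:V^\ell\to V_h^{\ell,c}$ with $\operatorname{curl}\Pi_0=\Pi_1\operatorname{curl}$ and $\operatorname{div}\Pi_1=\Pi_2\operatorname{div}$). Discrete dual gradient: $\widetilde{\mathrm{grad}}_h:V_h^{2,c}\to V_h^{1,c}$ is defined by $\int_\Omega \widetilde{\mathrm{grad}}_h q_h\cdot\mathbf v_h=-\int_\Omega q_h\operatorname{div}\mathbf v_h$ for all $q_h\in V_h^{2,c}$, $\mathbf v_h\in V_h^{1,c}$. Discrete interior product: for a vector $\mathbf a\in\mathbb R^2$, $\tilde\imath^{0h}_{\mathbf a}\mathbf u_h=\tilde P_h^0(\mathbf a\cdot\mathbf u_h)$, with $\tilde P_h^0$ the $L^2$-orthogonal projection onto $V_h^{2,c}$. With $\mathbf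 e_1,\mathbf e_2$ the canonical basis and $P_h^1$ the $L^2$-orthogonal projection onto $V_h^{1,c}$, $$s_h(\mathbf u_h,\mathbf v_h)=\tfrac12P_h^1\Big(\sum_{k=1}^{2}(\tilde\imath^{0h}_{\mathbf e_k}\mathbf v_h)\,\widetilde{\mathrm{grad}}_h(\tilde\imath^{0h}_{\mathbf e_k}\mathbf u_h)-(\tilde\imath^{0h}_{\mathbf e_k}\mathbf u_h)\,\widetilde{\mathrm{grad}}_h(\tilde\imath^{0h}_{\mathbf e_k}\mathbf v_h)\Big).$$ *)

theory Defs
  imports "HOL-Analysis.Analysis"
begin

text \<open>
  Elements of the function spaces are represented by functions on \<^typ>\<open>real^2\<close>; those that agree
  almost everywhere on the domain represent the same element. Operators that are determined only up
  to null sets (weak derivatives, orthogonal projections, the discrete gradient) choose a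
  representative by Hilbert choice.
\<close>

subsection \<open>Domains\<close>

text \<open>
  \<open>Periodic a b\<close> is the rectangle with corners \<open>a\<close>, \<open>b\<close> and opposite sides identified;
  \<open>Homogeneous \<Omega>\<close> is \<open>\<Omega>\<close> with homogeneous boundary conditions.
\<close>

datatype flow_domain = Periodic "real^2" "real^2" | Homogeneous "(real^2) set"

fun cell :: "flow_domain \<Rightarrow> (real^2) set" where
  "cell (Periodic a b) = box a b"
| "cell (Homogeneous \<Omega>) = \<Omega>"

abbreviation dmeas :: "flow_domain \<Rightarrow> (real^2) measure" where
  "dmeas D \<equiv> lebesgue_on (cell D)"

text \<open>
  Near each boundary point \<open>x\<close>, in the orthonormal frame \<open>(e, n)\<close> centred at \<open>x\<close>, the domain is the
  strict epigraph of a Lipschitz function.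
\<close>

definition lipschitz_boundary :: "(real^2) set \<Rightarrow> bool" where
  "lipschitz_boundary \<Omega> \<longleftrightarrow>
     (\<forall>x \<in> frontier \<Omega>. \<exists>r > 0. \<exists>e n. \<exists>L. \<exists>g :: real \<Rightarrow> real.
        norm e = 1 \<and> norm n = 1 \<and> e \<bullet> n = 0 \<and> L-lipschitz_on UNIV g \<and>
        \<Omega> \<inter> ball x r = {y \<in> ball x r. (y - x) \<bullet> n > g ((y - x) \<bullet> e)})"

fun admissible_domain :: "flow_domain \<Rightarrow> bool" where
  "admissible_domain (Periodic a b) \<longleftrightarrow> (\<forall>i. a $ i < b $ i)"
| "admissible_domain (Homogeneous \<Omega>) \<longleftrightarrow>
     open \<Omega> \<and> connected \<Omega> \<and> \<Omega> \<noteq> {} \<and> bounded \<Omega> \<and> lipschitz_boundary \<Omega>"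

fun periodic_on :: "flow_domain \<Rightarrow> (real^2 \<Rightarrow> 'b) \<Rightarrow> bool" where
  "periodic_on (Periodic a b) f \<longleftrightarrow> (\<forall>x i. f (x + axis i (b $ i - a $ i)) = f x)"
| "periodic_on (Homogeneous \<Omega>) f \<longleftrightarrow> True"

subsection \<open>Smooth test functions\<close>

definition pd :: "2 \<Rightarrow> (real^2 \<Rightarrow> real) \<Rightarrow> real^2 \<Rightarrow> real" where
  "pd i f x = frechet_derivative f (at x) (axis i 1)"

fun C_k :: "nat \<Rightarrow> (real^2 \<Rightarrow> real) \<Rightarrow> bool" where
  "C_k 0 f \<longleftrightarrow> continuous_on UNIV f"
| "C_k (Suc k) f \<longleftrightarrow> (\<forall>x. f differentiable (at x)) \<and> (\<forall>i. C_k k (pd i f))"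

definition smooth :: "(real^2 \<Rightarrow> real) \<Rightarrow> bool" where
  "smooth f \<longleftrightarrow> (\<forall>k. C_k k f)"

fun test_fun :: "flow_domain \<Rightarrow> (real^2 \<Rightarrow> real) \<Rightarrow> bool" where
  "test_fun (Periodic a b) \<phi> \<longleftrightarrow> smooth \<phi> \<and> periodic_on (Periodic a b) \<phi>"
| "test_fun (Homogeneous \<Omega>) \<phi> \<longleftrightarrow>
     smooth \<phi> \<and> compact (closure {x. \<phi> x \<noteq> 0}) \<and> closure {x. \<phi> x \<noteq> 0} \<subseteq> \<Omega>"

subsection \<open>The spaces \<open>L\<^sup>2\<close>, \<open>H\<^sup>1\<close> and \<open>H(div)\<close>\<close>

definition L2 :: "flow_domain \<Rightarrow> (real^2 \<Rightarrow> 'b::euclidean_space) set" where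
  "L2 D = {f. f \<in> borel_measurable (dmeas D) \<and>
              integrable (dmeas D) (\<lambda>x. (norm (f x))\<^sup>2) \<and> periodic_on D f}"

definition L2_inner ::
  "flow_domain \<Rightarrow> (real^2 \<Rightarrow> 'b::euclidean_space) \<Rightarrow> (real^2 \<Rightarrow> 'b) \<Rightarrow> real" where
  "L2_inner D f g = (LINT x|dmeas D. f x \<bullet> g x)"

definition L2_norm :: "flow_domain \<Rightarrow> (real^2 \<Rightarrow> 'b::euclidean_space) \<Rightarrow> real" where
  "L2_norm D f = sqrt (L2_inner D f f)"

definition has_weak_pd ::
  "flow_domain \<Rightarrow> 2 \<Rightarrow> (real^2 \<Rightarrow> real) \<Rightarrow> (real^2 \<Rightarrow> real) \<Rightarrow> bool" where
  "has_weak_pd D i f g \<longleftrightarrow> f \<in> L2 D \<and> g \<in> L2 D \<and>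
     (\<forall>\<phi>. test_fun D \<phi> \<longrightarrow> (LINT x|dmeas D. f x * pd i \<phi> x) = - (LINT x|dmeas D. g x * \<phi> x))"

definition weak_pd :: "flow_domain \<Rightarrow> 2 \<Rightarrow> (real^2 \<Rightarrow> real) \<Rightarrow> real^2 \<Rightarrow> real" where
  "weak_pd D i f = (SOME g. has_weak_pd D i f g)"

definition weak_curl :: "flow_domain \<Rightarrow> (real^2 \<Rightarrow> real) \<Rightarrow> real^2 \<Rightarrow> real^2" where
  "weak_curl D \<omega> = (\<lambda>x. vector [weak_pd D 2 \<omega> x, - weak_pd D 1 \<omega> x])"

definition has_weak_div ::
  "flow_domain \<Rightarrow> (real^2 \<Rightarrow> real^2) \<Rightarrow> (real^2 \<Rightarrow> real) \<Rightarrow> bool" where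
  "has_weak_div D v d \<longleftrightarrow> v \<in> L2 D \<and> d \<in> L2 D \<and>
     (\<forall>\<phi>. test_fun D \<phi> \<longrightarrow>
        (LINT x|dmeas D. v x \<bullet> (\<chi> i. pd i \<phi> x)) = - (LINT x|dmeas D. d x * \<phi> x))"

definition weak_div :: "flow_domain \<Rightarrow> (real^2 \<Rightarrow> real^2) \<Rightarrow> real^2 \<Rightarrow> real" where
  "weak_div D v = (SOME d. has_weak_div D v d)"

definition H1 :: "flow_domain \<Rightarrow> (real^2 \<Rightarrow> real) set" where
  "H1 D = {f. \<forall>i. \<exists>g. has_weak_pd D i f g}"

definition Hdiv :: "flow_domain \<Rightarrow> (real^2 \<Rightarrow> real^2) set" where
  "Hdiv D = {v. \<exists>d. has_weak_div D v d}"

definition H1_norm :: "flow_domain \<Rightarrow> (real^2 \<Rightarrow> real) \<Rightarrow> real" where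
  "H1_norm D f = sqrt ((L2_norm D f)\<^sup>2 + (\<Sum>i\<in>UNIV. (L2_norm D (weak_pd D i f))\<^sup>2))"

definition Hdiv_norm :: "flow_domain \<Rightarrow> (real^2 \<Rightarrow> real^2) \<Rightarrow> real" where
  "Hdiv_norm D v = sqrt ((L2_norm D v)\<^sup>2 + (L2_norm D (weak_div D v))\<^sup>2)"

text \<open>
  With homogeneous boundary conditions, \<open>V0\<close> and \<open>V1\<close> are the closures of the smooth compactly
  supported functions in \<open>H\<^sup>1\<close> and \<open>H(div)\<close>.
\<close>

fun V0 :: "flow_domain \<Rightarrow> (real^2 \<Rightarrow> real) set" where
  "V0 (Periodic a b) = H1 (Periodic a b)"
| "V0 (Homogeneous \<Omega>) =
     {f \<in> H1 (Homogeneous \<Omega>). \<forall>\<epsilon> > 0. \<exists>\<phi>. test_fun (Homogeneous \<Omega>) \<phi> \<and>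
        H1_norm (Homogeneous \<Omega>) (\<lambda>x. f x - \<phi> x) < \<epsilon>}"

fun V1 :: "flow_domain \<Rightarrow> (real^2 \<Rightarrow> real^2) set" where
  "V1 (Periodic a b) = Hdiv (Periodic a b)"
| "V1 (Homogeneous \<Omega>) =
     {v \<in> Hdiv (Homogeneous \<Omega>). \<forall>\<epsilon> > 0. \<exists>\<phi>. (\<forall>i. test_fun (Homogeneous \<Omega>) (\<lambda>x. \<phi> x $ i)) \<and>
        Hdiv_norm (Homogeneous \<Omega>) (\<lambda>x. v x - \<phi> x) < \<epsilon>}"

definition V2 :: "flow_domain \<Rightarrow> (real^2 \<Rightarrow> real) set" where
  "V2 D = L2 D"

subsection \<open>Discrete spaces\<close>

definition ae_eq :: "flow_domain \<Rightarrow> (real^2 \<Rightarrow> 'b) \<Rightarrow> (real^2 \<Rightarrow> 'b) \<Rightarrow> bool" where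
  "ae_eq D f g \<longleftrightarrow> (AE x in dmeas D. f x = g x)"

definition fin_dim_fun_space :: "('a \<Rightarrow> 'b::real_vector) set \<Rightarrow> bool" where
  "fin_dim_fun_space V \<longleftrightarrow>
     (\<exists>B. finite B \<and> V = {f. \<exists>c. f = (\<lambda>x. \<Sum>\<beta>\<in>B. c \<beta> *\<^sub>R \<beta> x)})"

definition discrete_subspace ::
  "flow_domain \<Rightarrow> (real^2 \<Rightarrow> 'b::euclidean_space) set \<Rightarrow> (real^2 \<Rightarrow> 'b) set \<Rightarrow> bool" where
  "discrete_subspace D V Vh \<longleftrightarrow>
     Vh \<subseteq> V \<and> fin_dim_fun_space Vh \<and> (\<forall>f \<in> Vh. bounded (f ` cell D))"

text \<open>Linear idempotent maps onto \<open>Vh\<close>, on elements taken modulo null sets.\<close>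

definition space_projection ::
  "flow_domain \<Rightarrow> (real^2 \<Rightarrow> 'b::euclidean_space) set \<Rightarrow> (real^2 \<Rightarrow> 'b) set \<Rightarrow>
   ((real^2 \<Rightarrow> 'b) \<Rightarrow> (real^2 \<Rightarrow> 'b)) \<Rightarrow> bool" where
  "space_projection D V Vh P \<longleftrightarrow>
     (\<forall>f \<in> V. P f \<in> Vh) \<and>
     (\<forall>f \<in> V. \<forall>g \<in> V. ae_eq D f g \<longrightarrow> ae_eq D (P f) (P g)) \<and>
     (\<forall>f \<in> V. \<forall>g \<in> V. \<forall>c d. ae_eq D (P (\<lambda>x. c *\<^sub>R f x + d *\<^sub>R g x)) (\<lambda>x. c *\<^sub>R P f x + d *\<^sub>R P g x)) \<and>
     (\<forall>f \<in> Vh. ae_eq D (P f) f)"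

definition conforming_complex ::
  "flow_domain \<Rightarrow> (real^2 \<Rightarrow> real) set \<Rightarrow> (real^2 \<Rightarrow> real^2) set \<Rightarrow> (real^2 \<Rightarrow> real) set \<Rightarrow> bool" where
  "conforming_complex D V0h V1h V2h \<longleftrightarrow>
     discrete_subspace D (V0 D) V0h \<and> discrete_subspace D (V1 D) V1h \<and>
     discrete_subspace D (V2 D) V2h \<and>
     (\<forall>\<omega> \<in> V0h. \<exists>v \<in> V1h. ae_eq D (weak_curl D \<omega>) v) \<and>
     (\<forall>v \<in> V1h. \<exists>q \<in> V2h. ae_eq D (weak_div D v) q) \<and>
     (\<exists>P0 P1 P2.
        space_projection D (V0 D) V0h P0 \<and> space_projection D (V1 D) V1h P1 \<and>
        space_projection D (V2 D) V2h P2 \<and>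
        (\<forall>\<omega> \<in> V0 D. ae_eq D (weak_curl D (P0 \<omega>)) (P1 (weak_curl D \<omega>))) \<and>
        (\<forall>v \<in> V1 D. ae_eq D (weak_div D (P1 v)) (P2 (weak_div D v))))"

subsection \<open>Discrete operators\<close>

definition L2_proj ::
  "flow_domain \<Rightarrow> (real^2 \<Rightarrow> 'b::euclidean_space) set \<Rightarrow> (real^2 \<Rightarrow> 'b) \<Rightarrow> real^2 \<Rightarrow> 'b" where
  "L2_proj D Vh f = (SOME g. g \<in> Vh \<and> (\<forall>w \<in> Vh. L2_inner D (\<lambda>x. f x - g x) w = 0))"

definition grad_h ::
  "flow_domain \<Rightarrow> (real^2 \<Rightarrow> real^2) set \<Rightarrow> (real^2 \<Rightarrow> real) \<Rightarrow> real^2 \<Rightarrow> real^2" where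
  "grad_h D V1h q =
     (SOME g. g \<in> V1h \<and> (\<forall>v \<in> V1h. L2_inner D g v = - L2_inner D q (weak_div D v)))"

definition interior_h ::
  "flow_domain \<Rightarrow> (real^2 \<Rightarrow> real) set \<Rightarrow> real^2 \<Rightarrow> (real^2 \<Rightarrow> real^2) \<Rightarrow> real^2 \<Rightarrow> real" where
  "interior_h D V2h a u = L2_proj D V2h (\<lambda>x. a \<bullet> u x)"

definition s_h ::
  "flow_domain \<Rightarrow> (real^2 \<Rightarrow> real^2) set \<Rightarrow> (real^2 \<Rightarrow> real) set \<Rightarrow>
   (real^2 \<Rightarrow> real^2) \<Rightarrow> (real^2 \<Rightarrow> real^2) \<Rightarrow> real^2 \<Rightarrow> real^2" where
  "s_h D V1h V2h u v = (\<lambda>x. (1/2) *\<^sub>R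
     L2_proj D V1h (\<lambda>y. \<Sum>k\<in>UNIV.
        interior_h D V2h (axis k 1) v y *\<^sub>R grad_h D V1h (interior_h D V2h (axis k 1) u) y -
        interior_h D V2h (axis k 1) u y *\<^sub>R grad_h D V1h (interior_h D V2h (axis k 1) v) y) x)"

subsection \<open>Continuous differentiability in time\<close>

text \<open>
  \<open>du\<close> is the time derivative of \<open>u : [0,T] \<rightarrow> Vh\<close> and is continuous, both with respect to the \<open>L\<^sup>2\<close>
  norm; \<open>Vh\<close> being finite-dimensional, any other norm gives the same notion.
\<close>

definition C1_in_time ::
  "flow_domain \<Rightarrow> real \<Rightarrow> (real^2 \<Rightarrow> 'b::euclidean_space) set \<Rightarrow>
   (real \<Rightarrow> real^2 \<Rightarrow> 'b) \<Rightarrow> (real \<Rightarrow> real^2 \<Rightarrow> 'b) \<Rightarrow> bool" where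
  "C1_in_time D T Vh u du \<longleftrightarrow>
     (\<forall>t \<in> {0..T}. u t \<in> Vh \<and> du t \<in> Vh \<and>
        ((\<lambda>s. L2_norm D (\<lambda>x. (u s x - u t x) /\<^sub>R (s - t) - du t x)) \<longlongrightarrow> 0) (at t within {0..T}) \<and>
        ((\<lambda>s. L2_norm D (\<lambda>x. du s x - du t x)) \<longlongrightarrow> 0) (at t within {0..T}))"

end

theory Submission
  imports Defs
begin

text \<open>
  Testing the momentum equation with \<open>u\<close> itself, the convection term vanishes because \<open>s\<^sub>h(u, u)\<close> is
  the projection of \<open>0\<close>, so \<open>(du, u) = - (grad p, u)\<close>. Testing it with \<open>grad q\<close> and subtracting the
  pressure equation gives \<open>(du, grad q) = 0\<close>, so \<open>(u, grad q)\<close> keeps its initial value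
  \<open>- (q, div u(0)) = 0\<close>; take \<open>q = p\<close>.

  This needs \<open>grad_h\<close>, a Hilbert choice, to satisfy its defining equation. A Riesz representer exists
  on the finite-dimensional space once \<open>v \<mapsto> (q, weak_div v)\<close> is linear, that is, once weak divergences
  are unique up to null sets. Uniqueness follows by approximating indicators of boxes with smooth
  functions \<open>h (n g\<^sub>1(x\<^sub>1)) h (n g\<^sub>2(x\<^sub>2))\<close> as \<open>n \<rightarrow> \<infinity>\<close>, where \<open>h(t) = exp(-1/t)\<close> for \<open>t > 0\<close> and \<open>g\<^sub>i\<close>
  is positive exactly on the \<open>i\<close>-th side of the box: a quadratic in the bounded case, and
  \<open>cos (\<dots>) - const\<close>, which is already periodic, in the periodic case.
\<close>

subsection \<open>Smooth test functions approximating indicators of boxes\<close>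

lemma pd_eq: "(f has_derivative f') (at x) \<Longrightarrow> pd i f x = f' (axis i 1)"
  unfolding pd_def by (metis frechet_derivative_at)

lemma has_derivative_frechet: "f differentiable (at x) \<Longrightarrow> (f has_derivative frechet_derivative f (at x)) (at x)"
  by (simp add: frechet_derivative_works)

text \<open>The recursion for \<open>C_k\<close> never asks for the lower orders directly:
  differentiability yields continuity at order 0, and the induction passes this on to the partial
  derivatives. The product rule needs it, since it leaves one factor undifferentiated.\<close>

lemma C_k_Suc_imp: "C_k (Suc k) f \<Longrightarrow> C_k k f"
proof (induction k arbitrary: f)
  case 0
  then show ?case
    by (auto intro!: continuous_at_imp_continuous_on differentiable_imp_continuous_within)
next
  case (Suc k)
  then show ?case by (metis C_k.simps(2))
qed

lemma C_k_add: "C_k k f \<Longrightarrow> C_k k g \<Longrightarrow> C_k k (\<lambda>x. f x + g x)"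
proof (induction k arbitrary: f g)
  case (Suc k)
  have "pd i (\<lambda>x. f x + g x) = (\<lambda>x. pd i f x + pd i g x)" for i
  proof
    fix x
    have "((\<lambda>x. f x + g x) has_derivative
        (\<lambda>v. frechet_derivative f (at x) v + frechet_derivative g (at x) v)) (at x)"
      using Suc.prems by (intro has_derivative_add has_derivative_frechet) auto
    then show "pd i (\<lambda>x. f x + g x) x = pd i f x + pd i g x"
      by (simp add: pd_eq) (simp add: pd_def)
  qed
  then show ?case using Suc by (simp add: differentiable_add)
qed (simp add: continuous_on_add)

lemma C_k_mult: "C_k k f \<Longrightarrow> C_k k g \<Longrightarrow> C_k k (\<lambda>x. f x * g x)"
proof (induction k arbitrary: f g)
  case (Suc k)
  have "pd i (\<lambda>x. f x * g x) = (\<lambda>x. f x * pd i g x + pd i f x * g x)" for i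
  proof
    fix x
    have "((\<lambda>x. f x * g x) has_derivative
        (\<lambda>v. f x * frechet_derivative g (at x) v + frechet_derivative f (at x) v * g x)) (at x)"
      using Suc.prems by (intro has_derivative_mult has_derivative_frechet) auto
    then show "pd i (\<lambda>x. f x * g x) x = f x * pd i g x + pd i f x * g x"
      by (simp add: pd_eq) (simp add: pd_def)
  qed
  moreover have "C_k k (\<lambda>x. f x * pd i g x + pd i f x * g x)" for i
    using Suc.prems by (intro C_k_add Suc.IH) (simp_all add: C_k_Suc_imp)
  ultimately show ?case using Suc.prems by (simp add: differentiable_mult)
qed (simp add: continuous_on_mult)

lemma C_k_const: "C_k k (\<lambda>x. c)"
proof (induction k arbitrary: c)
  case (Suc k)
  have "pd i (\<lambda>x. c) = (\<lambda>x. 0)" for i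
    by (rule ext, subst pd_eq[OF has_derivative_const]) simp
  with Suc show ?case by auto
qed auto

lemma C_k_component: "C_k k (\<lambda>x. x $ j)"
proof (cases k)
  case (Suc l)
  have D: "((\<lambda>x::real^2. x $ j) has_derivative (\<lambda>x. x $ j)) (at x)" for x
    by (rule bounded_linear.has_derivative[OF bounded_linear_vec_nth has_derivative_ident])
  have "pd i (\<lambda>x. x $ j) = (\<lambda>x. axis i 1 $ j)" for i
    by (rule ext, subst pd_eq[OF D]) simp
  with Suc D C_k_const show ?thesis by (auto simp: differentiable_def)
qed (auto intro: continuous_intros)

lemma smooth_add: "smooth f \<Longrightarrow> smooth g \<Longrightarrow> smooth (\<lambda>x. f x + g x)"
  and smooth_mult: "smooth f \<Longrightarrow> smooth g \<Longrightarrow> smooth (\<lambda>x. f x * g x)"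
  and smooth_const: "smooth (\<lambda>x. c)"
  and smooth_component: "smooth (\<lambda>x. x $ j)"
  by (simp_all add: smooth_def C_k_add C_k_mult C_k_const C_k_component)

lemma smooth_diff: "smooth f \<Longrightarrow> smooth g \<Longrightarrow> smooth (\<lambda>x. f x - g x)"
  using smooth_add[OF _ smooth_mult[OF smooth_const[of "-1"]], of f g] by simp

lemma smooth_pd: "smooth f \<Longrightarrow> smooth (pd i f)"
  unfolding smooth_def by (metis C_k.simps(2))

lemma smooth_continuous: "smooth f \<Longrightarrow> continuous_on UNIV f"
  unfolding smooth_def by (metis C_k.simps(1))

lemma smooth_differentiable: "smooth f \<Longrightarrow> f differentiable (at x)"
  unfolding smooth_def by (metis C_k.simps(2))

text \<open>The outer function comes as the whole sequence \<open>F\<close> of its successive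
  derivatives. By the chain rule a partial derivative of \<open>F j\<close> after \<open>g\<close>
  is \<open>F (Suc j)\<close> after \<open>g\<close> times \<open>pd i g\<close>, so an induction on
  the order, for all \<open>j\<close> at once, closes.\<close>

lemma smooth_compose:
  fixes F :: "nat \<Rightarrow> real \<Rightarrow> real"
  assumes F: "\<And>j t. (F j has_real_derivative F (Suc j) t) (at t)" and g: "smooth g"
  shows "smooth (\<lambda>x. F j (g x))"
proof -
  have "C_k k (\<lambda>x. F j (g x))" for k
  proof (induction k arbitrary: j)
    case 0
    have "continuous_on UNIV (F j)"
      using F by (auto intro!: continuous_at_imp_continuous_on DERIV_isCont)
    then show ?case
      using smooth_continuous[OF g] by (auto intro: continuous_on_compose2)
  next
    case (Suc k)
    have D: "((\<lambda>x. F j (g x)) has_derivative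
        (\<lambda>v. F (Suc j) (g x) * frechet_derivative g (at x) v)) (at x)" for x
      using has_derivative_compose[OF has_derivative_frechet[OF smooth_differentiable[OF g]]
          F[of j, unfolded has_field_derivative_def]] by simp
    have "pd i (\<lambda>x. F j (g x)) = (\<lambda>x. F (Suc j) (g x) * pd i g x)" for i
      by (rule ext, subst pd_eq[OF D]) (simp add: pd_def)
    then show ?case
      using Suc smooth_pd[OF g] D by (auto simp: smooth_def intro!: C_k_mult differentiableI[OF D])
  qed
  then show ?thesis by (simp add: smooth_def)
qed

section \<open>The flat function exp(-1/t) and the cosine\<close>

text \<open>Differentiating keeps the shape \<open>p(1/t) exp(-1/t)\<close> and replaces \<open>p\<close> by \<open>X\<^sup>2 (p - p')\<close>.\<close>

definition flat :: "real poly \<Rightarrow> real \<Rightarrow> real" where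
  "flat p t = (if t > 0 then poly p (1 / t) * exp (- (1 / t)) else 0)"

lemma poly_times_exp_minus_tendsto_0:
  fixes p :: "real poly"
  shows "((\<lambda>y. poly p y * exp (- y)) \<longlongrightarrow> 0) at_top"
proof -
  have "((\<lambda>y. \<Sum>i\<le>degree p. coeff p i * (y ^ i / exp y)) \<longlongrightarrow> (\<Sum>i\<le>degree p. coeff p i * 0)) at_top"
    by (intro tendsto_intros tendsto_power_div_exp_0)
  then show ?thesis
    by (simp add: poly_altdef exp_minus sum_distrib_right divide_inverse mult.assoc)
qed

lemma flat_has_derivative:
  "(flat p has_real_derivative flat (monom 1 2 * (p - pderiv p)) t) (at t)"
proof (cases t "0::real" rule: linorder_cases)
  case less
  have "((\<lambda>_. 0) has_real_derivative 0) (at t)" by simp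
  from has_field_derivative_transform_within_open[OF this, of "{..<0}" "flat p"]
  show ?thesis using less by (auto simp: flat_def)
next
  case greater
  have I: "((\<lambda>t. 1 / t) has_real_derivative - ((1 / t)\<^sup>2)) (at t)"
    using greater by (auto intro!: derivative_eq_intros simp: power2_eq_square)
  have "((\<lambda>t. poly p (1 / t) * exp (- (1 / t))) has_real_derivative
      (poly (pderiv p) (1 / t) * - ((1 / t)\<^sup>2)) * exp (- (1 / t))
        + (exp (- (1 / t)) * - (- ((1 / t)\<^sup>2))) * poly p (1 / t)) (at t)"
    by (intro DERIV_mult DERIV_chain2[OF poly_DERIV I] DERIV_fun_exp DERIV_minus I)
  then have "((\<lambda>t. poly p (1 / t) * exp (- (1 / t))) has_real_derivative
      poly (monom 1 2 * (p - pderiv p)) (1 / t) * exp (- (1 / t))) (at t)"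
    by (rule DERIV_cong) (simp add: poly_monom algebra_simps)
  from has_field_derivative_transform_within_open[OF this, of "{0<..}" "flat p"]
  show ?thesis using greater by (auto simp: flat_def)
next
  case equal
  \<comment> \<open>With y = 1/h, the difference quotient from the right is y p(y) exp(-y), and y
    tends to infinity. From the left it is constantly 0.\<close>
  have "((\<lambda>h. poly (monom 1 1 * p) (inverse h) * exp (- inverse h)) \<longlongrightarrow> 0) (at_right 0)"
    by (rule filterlim_compose[OF poly_times_exp_minus_tendsto_0 filterlim_inverse_at_top_right])
  then have "((\<lambda>h. (flat p (0 + h) - flat p 0) / h) \<longlongrightarrow> 0) (at_right 0)"
    by (rule Lim_transform_eventually)
       (auto simp: eventually_at_filter flat_def poly_monom field_simps)
  moreover have "((\<lambda>h. (flat p (0 + h) - flat p 0) / h) \<longlongrightarrow> 0) (at_left 0)"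
    by (rule Lim_transform_eventually[OF tendsto_const])
       (auto simp: eventually_at_filter flat_def)
  ultimately show ?thesis
    using equal unfolding DERIV_def by (auto simp: filterlim_at_split flat_def)
qed

lemma smooth_flat: "smooth g \<Longrightarrow> smooth (\<lambda>x. flat p (g x))"
  \<comment> \<open>The \<open>j\<close>-th derivative belongs to the \<open>j\<close>-fold iterate
    of the polynomial map; index 0 is \<open>flat p\<close> itself.\<close>
  using smooth_compose[of "\<lambda>j. flat (((\<lambda>p. monom 1 2 * (p - pderiv p)) ^^ j) p)" g 0]
  by (simp add: flat_has_derivative)

lemma smooth_cos: "smooth g \<Longrightarrow> smooth (\<lambda>x. cos (g x))"
proof -
  \<comment> \<open>Each differentiation of the cosine is a shift by a quarter turn, so one formula
    covers all orders.\<close>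
  have "((\<lambda>t. cos (t + real j * (pi / 2))) has_real_derivative cos (t + real (Suc j) * (pi / 2))) (at t)" for j t
  proof -
    have "t + real (Suc j) * (pi / 2) = (t + real j * (pi / 2)) + pi / 2"
      by (simp add: field_simps)
    then have "cos (t + real (Suc j) * (pi / 2)) = - sin (t + real j * (pi / 2))"
      by (metis cos_add cos_pi_half mult_zero_right diff_0 sin_pi_half mult_1_right)
    then show ?thesis
      by (auto intro!: derivative_eq_intros)
  qed
  from smooth_compose[where F = "\<lambda>j t. cos (t + real j * (pi / 2))", OF this, of g 0]
  show "smooth g \<Longrightarrow> ?thesis" by simp
qed

lemma flat_1_bounds: "0 \<le> flat 1 t" "flat 1 t \<le> 1"
  by (auto simp: flat_def)

lemma flat_1_eq_0_iff: "flat 1 t = 0 \<longleftrightarrow> t \<le> 0"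
  by (auto simp: flat_def)

text \<open>For positive t the terms with n > 0 are exp(-1/(n t)), whose exponent tends to 0;
  otherwise every term is 0. Only the sign of t survives in the limit.\<close>

lemma flat_1_scaled_tendsto:
  "(\<lambda>n. flat 1 (real n * t)) \<longlonglongrightarrow> (if t > 0 then 1 else 0)"
proof (cases "t > 0")
  case True
  have "(\<lambda>n. exp (- (inverse t * inverse (real n)))) \<longlonglongrightarrow> exp (- (inverse t * 0))"
    by (intro tendsto_intros lim_inverse_n)
  moreover have "eventually (\<lambda>n. exp (- (inverse t * inverse (real n))) = flat 1 (real n * t)) sequentially"
    using eventually_gt_at_top[of 0] by eventually_elim (use True in \<open>simp add: flat_def divide_inverse\<close>)
  ultimately have "(\<lambda>n. flat 1 (real n * t)) \<longlonglongrightarrow> exp (- (inverse t * 0))"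
    by (rule Lim_transform_eventually)
  then show ?thesis using True by simp
next
  case False
  then show ?thesis by (simp add: flat_def zero_less_mult_iff)
qed

subsection \<open>The fundamental lemma of the calculus of variations\<close>

text \<open>Dynkin's argument: open boxes are stable under intersection and generate the Borel sets,
  and the sets over which the integral vanishes are closed under complements and countable disjoint
  unions. A density that integrates to 0 over every Borel set is null.\<close>

lemma AE_zero_if_box_integrals_zero:
  fixes f :: "'a::euclidean_space \<Rightarrow> real"
  assumes f: "integrable lebesgue f"
    and box: "\<And>a b. (LINT x|lebesgue. indicator (box a b) x * f x) = 0"
  shows "AE x in lebesgue. f x = 0"
proof -
  \<comment> \<open>The induction runs over Borel sets, so \<open>f\<close> gives way to a Borel
    function equal to it almost everywhere.\<close>
  obtain g where g: "g \<in> borel_measurable lborel" and fg: "AE x in lborel. f x = g x"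
    using completion_ex_borel_measurable_real f by blast
  have fgL: "AE x in lebesgue. f x = g x"
    by (rule AE_completion[OF fg])
  have fm: "f \<in> borel_measurable lebesgue" and gm: "g \<in> borel_measurable lebesgue"
    using f g by (blast intro: borel_measurable_integrable measurable_completion)+
  have gL: "integrable lebesgue g"
    using integrable_cong_AE[OF fm gm fgL] f by blast
  have gi: "integrable lborel g"
    using gL g by (simp add: integrable_completion)
  have int: "integrable lborel (\<lambda>x. indicator A x * g x)" if "A \<in> sets borel" for A
    using integrable_mult_indicator[OF _ gi, of A] that by simp
  have g_box: "(LINT x|lborel. indicator (box a b) x * g x) = 0" for a b
  proof -
    have "(LINT x|lborel. indicator (box a b) x * g x) = (LINT x|lebesgue. indicator (box a b) x * g x)"
      using g by (subst integral_completion) auto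
    also have "\<dots> = (LINT x|lebesgue. indicator (box a b) x * f x)"
    proof (rule integral_cong_AE)
      show "AE x in lebesgue. indicator (box a b) x * g x = indicator (box a b) x * f x"
        using fgL by eventually_elim simp
    qed (intro borel_measurable_times borel_measurable_indicator fm gm; simp)+
    finally show ?thesis using box by simp
  qed
  \<comment> \<open>The complement step needs the integral over the whole space, which is exhausted
    by growing boxes; |g| is the majorant.\<close>
  have g_all: "(LINT x|lborel. g x) = 0"
  proof (rule LIMSEQ_unique)
    show "(\<lambda>n. LINT x|lborel. indicator (box (- (real n *\<^sub>R One)) (real n *\<^sub>R One)) x * g x)
        \<longlonglongrightarrow> (LINT x|lborel. g x)"
    proof (rule integral_dominated_convergence[where w = "\<lambda>x. \<bar>g x\<bar>"])
      show "AE x in lborel. (\<lambda>n. indicator (box (- (real n *\<^sub>R One)) (real n *\<^sub>R One)) x * g x)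
          \<longlonglongrightarrow> g x"
      proof (rule AE_I2)
        fix x :: 'a
        obtain N :: nat where N: "x \<in> box (- (real N *\<^sub>R One)) (real N *\<^sub>R One)"
          using UN_box_eq_UNIV by blast
        have "eventually (\<lambda>n. g x = indicator (box (- (real n *\<^sub>R One)) (real n *\<^sub>R One)) x * g x) sequentially"
          using eventually_ge_at_top[of N]
        proof eventually_elim
          case (elim n)
          have "- real n < x \<bullet> i \<and> x \<bullet> i < real n" if "i \<in> Basis" for i
          proof -
            have "- real N < x \<bullet> i \<and> x \<bullet> i < real N"
              using N that by (simp add: mem_box)
            moreover have "real N \<le> real n" using elim by simp
            ultimately show ?thesis by linarith
          qed
          then have "x \<in> box (- (real n *\<^sub>R One)) (real n *\<^sub>R One)"
            by (simp add: mem_box)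
        then show ?case by simp
        qed
        then show "(\<lambda>n. indicator (box (- (real n *\<^sub>R One)) (real n *\<^sub>R One)) x * g x) \<longlonglongrightarrow> g x"
          by (rule Lim_transform_eventually[OF tendsto_const])
      qed
    qed (use g gi int in \<open>auto simp: indicator_def\<close>)
  qed (simp add: g_box)
  have sets: "sets borel = sigma_sets UNIV (range (\<lambda>(a, b). box a b :: 'a set))"
    by (simp add: borel_eq_box)
  have boxes: "Int_stable (range (\<lambda>(a, b). box a b :: 'a set))"
    by (auto simp: Int_stable_def box_Int_box)
  have "(LINT x|lborel. indicator A x * g x) = 0" if "A \<in> sets borel" for A
    using boxes Pow_UNIV[THEN equalityD2, THEN subset_trans[OF subset_UNIV]] that[unfolded sets]
  proof (induction rule: sigma_sets_induct_disjoint)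
    case (compl A)
    then have A: "A \<in> sets borel" by (simp add: sets)
    have "(LINT x|lborel. indicator (UNIV - A) x * g x) = (LINT x|lborel. g x - indicator A x * g x)"
      by (intro Bochner_Integration.integral_cong) (auto simp: indicator_def)
    then show ?case using compl.IH g_all int[OF A] gi by simp
  next
    case (union A)
    then have A: "\<And>i. A i \<in> sets lborel" by (auto simp: sets)
    have "(LINT x:(\<Union>i. A i)|lborel. g x) = (\<Sum>i. LINT x:A i|lborel. g x)"
    proof (rule lebesgue_integral_countable_add[OF A])
      show "set_integrable lborel (\<Union> (range A)) g"
        using A int[of "\<Union> (range A)"] by (auto simp: set_integrable_def)
    qed (use union.hyps in \<open>auto simp: disjoint_family_on_def\<close>)
    then show ?case using union.IH by (simp add: set_lebesgue_integral_def)
  qed (use g_box in auto)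
  then have "AE x in lborel. g x = 0"
    by (intro sigma_finite_measure.density_zero[OF lborel.sigma_finite_measure_axioms gi]) (simp add: set_lebesgue_integral_def)
  then show ?thesis
    using fgL by (auto dest: AE_completion)
qed

text \<open>The hypothesis speaks only of boxes whose closure lies in \<open>S\<close>. Cutting
  \<open>f\<close> down to one closed box inside \<open>S\<close> makes the global statement
  applicable, because the intersection of any box with its interior is again such a box or empty.
  Countably many closed boxes then cover \<open>S\<close>.\<close>

lemma AE_zero_on_open:
  fixes f :: "'a::euclidean_space \<Rightarrow> real"
  assumes S: "open S" and f: "integrable (lebesgue_on S) f"
    and box: "\<And>a b. cbox a b \<subseteq> S \<Longrightarrow> box a b \<noteq> {} \<Longrightarrow>
      (LINT x|lebesgue_on S. indicator (box a b) x * f x) = 0"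
  shows "AE x in lebesgue_on S. f x = 0"
proof -
  have SL: "S \<in> sets lebesgue" using S by auto
  have fS: "integrable lebesgue (\<lambda>x. indicator S x * f x)"
    using f SL by (simp add: integrable_restrict_space)
  have Q: "AE x in lebesgue. x \<in> cbox c d \<longrightarrow> f x = 0" if cd: "cbox c d \<subseteq> S" for c d
  proof -
    have "AE x in lebesgue. indicator (box c d) x * (indicator S x * f x) = 0"
    proof (rule AE_zero_if_box_integrals_zero)
      show "integrable lebesgue (\<lambda>x. indicator (box c d) x * (indicator S x * f x))"
        using integrable_mult_indicator[OF _ fS, of "box c d"] by simp
      fix a b
      obtain a' b' where ab: "box a b \<inter> box c d = box a' b'"
        using box_Int_box by blast
      have "(LINT x|lebesgue. indicator (box a b) x * (indicator (box c d) x * (indicator S x * f x)))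
          = (LINT x|lebesgue. indicator (box a' b') x * (indicator S x * f x))"
        by (intro Bochner_Integration.integral_cong refl) (auto simp: ab[symmetric] indicator_def)
      also have "\<dots> = 0"
      proof (cases "box a' b' = {}")
        case False
        have "cbox a' b' \<subseteq> cbox c d"
        proof -
          have "closure (box a' b') \<subseteq> closure (box c d)"
            by (metis ab Int_lower2 closure_mono)
          moreover have "box c d \<noteq> {}" using ab False by auto
          ultimately show ?thesis using False by (simp add: closure_box)
        qed
        then have "(LINT x|lebesgue_on S. indicator (box a' b') x * f x) = 0"
          using cd False by (intro box) auto
        then show ?thesis
          using SL by (simp add: integral_restrict_space mult.left_commute)
      qed simp
      finally show "(LINT x|lebesgue. indicator (box a b) x * (indicator (box c d) x * (indicator S x * f x))) = 0" .
    qed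
    \<comment> \<open>The faces form a null set; the cover used below consists of closed
      boxes.\<close>
    moreover have "AE x in lebesgue. x \<notin> cbox c d - box c d"
      by (rule AE_not_in) (metis negligible_iff_null_sets negligible_frontier_interval)
    ultimately show ?thesis
      by eventually_elim (use cd in \<open>auto simp: indicator_def\<close>)
  qed
  obtain \<D> where D: "countable \<D>" "\<D> \<subseteq> Pow S" "\<And>X. X \<in> \<D> \<Longrightarrow> \<exists>a b. X = cbox a b" "\<Union>\<D> = S"
    using open_countable_Union_open_cbox[OF S] by metis
  have "AE x in lebesgue. x \<in> X \<longrightarrow> f x = 0" if "X \<in> \<D>" for X
    using Q D(2,3) that by blast
  then have "AE x in lebesgue. \<forall>X\<in>\<D>. x \<in> X \<longrightarrow> f x = 0"
    using AE_ball_countable[OF D(1), of "\<lambda>x X. x \<in> X \<longrightarrow> f x = 0" lebesgue] by blast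
  then show ?thesis
    using SL D(4) by (subst AE_restrict_space_iff) (simp, elim eventually_mono, blast)
qed

section \<open>Bump functions on both kinds of domain\<close>

lemma open_cell: "admissible_domain D \<Longrightarrow> open (cell D)"
  and bounded_cell: "admissible_domain D \<Longrightarrow> bounded (cell D)"
  by (atomize (full), cases D) (simp_all add: bounded_box open_box)

lemma finite_measure_dmeas: "admissible_domain D \<Longrightarrow> finite_measure (dmeas D)"
  by (rule finite_measure_lebesgue_on[OF lmeasurable_open[OF bounded_cell open_cell]])

text \<open>A cosine of period b - a, centred at the midpoint of (c, e), minus its value at the end
  points c and e. Within one period it exceeds that value exactly between them.\<close>

lemma periodic_bump_pos_iff:
  fixes a b c e t :: real
  assumes "a \<le> c" "c < e" "e \<le> b" "a < t" "t < b"
  shows "cos (2 * pi / (b - a) * (t - (c + e) / 2)) - cos (pi * (e - c) / (b - a)) > 0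
    \<longleftrightarrow> c < t \<and> t < e"
proof -
  define K where "K = 2 * pi / (b - a)"
  define w where "w = K * \<bar>t - (c + e) / 2\<bar>"
  define \<theta> where "\<theta> = K * ((e - c) / 2)"
  have L: "b - a > 0" using assms by linarith
  have K: "K > 0" "K * (b - a) = 2 * pi" using L by (simp_all add: K_def)
  have "K * ((e - c) / 2) \<le> K * ((b - a) / 2)"
    using assms K by (intro mult_left_mono) auto
  then have \<theta>: "0 \<le> \<theta>" "\<theta> \<le> pi"
    using assms K by (simp_all add: \<theta>_def)
  have w0: "0 \<le> w" using K by (simp add: w_def)
  \<comment> \<open>The period ends before the next bump begins, since a \<le> c and e \<le> b.
    Hence an angle \<open>w\<close> beyond pi reflects to 2 pi - w, which lies between
    \<open>\<theta>\<close> and pi, where the cosine is decreasing.\<close>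
  have "\<bar>t - (c + e) / 2\<bar> \<le> (b - a) - (e - c) / 2"
    by (rule abs_leI) (use assms in argo)+
  then have "w \<le> K * ((b - a) - (e - c) / 2)"
    unfolding w_def using K by (intro mult_left_mono) auto
  then have w1: "w \<le> 2 * pi - \<theta>"
    unfolding right_diff_distrib[of K "b - a"] K(2) \<theta>_def .
  have "cos w > cos \<theta> \<longleftrightarrow> w < \<theta>"
  proof (cases "w \<le> pi")
    case True
    then show ?thesis using cos_mono_less_eq[of \<theta> w] \<theta> w0 by simp
  next
    case False
    have "cos w = cos (2 * pi - w)" by (simp add: cos_diff)
    also have "\<dots> \<le> cos \<theta>"
      using False w1 \<theta> by (intro cos_monotone_0_pi_le) auto
    finally show ?thesis using False \<theta> by auto
  qed
  moreover have "w < \<theta> \<longleftrightarrow> \<bar>t - (c + e) / 2\<bar> < (e - c) / 2"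
    unfolding w_def \<theta>_def using K(1) by (rule mult_less_cancel_left_pos)
  moreover have "\<bar>t - (c + e) / 2\<bar> < (e - c) / 2 \<longleftrightarrow> c < t \<and> t < e"
  proof
    assume "\<bar>t - (c + e) / 2\<bar> < (e - c) / 2"
    then have "c < t" "t < e" unfolding abs_less_iff by argo+
    then show "c < t \<and> t < e" ..
  next
    assume "c < t \<and> t < e"
    then show "\<bar>t - (c + e) / 2\<bar> < (e - c) / 2" unfolding abs_less_iff by argo
  qed
  moreover have "cos w = cos (K * (t - (c + e) / 2))"
  proof (cases "t \<ge> (c + e) / 2")
    case False
    then have "\<bar>t - (c + e) / 2\<bar> = - (t - (c + e) / 2)" by linarith
    then show ?thesis by (simp only: w_def mult_minus_right cos_minus)
  qed (simp add: w_def)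
  moreover have "pi * (e - c) / (b - a) = \<theta>"
    using L by (simp add: \<theta>_def K_def divide_simps)
  ultimately show ?thesis unfolding K_def[symmetric] diff_gt_0_iff_gt by metis
qed

text \<open>That the closed box lies in the cell gives compact support inside the domain in the
  homogeneous case, and places the sides within one period in the periodic case. Convergence is
  claimed on the cell only, since the periodic functions repeat outside it.\<close>

lemma box_approximation:
  assumes adm: "admissible_domain D" and sub: "cbox c e \<subseteq> cell D" and ne: "box c e \<noteq> {}"
  obtains \<phi> :: "nat \<Rightarrow> real^2 \<Rightarrow> real"
  where "\<And>n. test_fun D (\<phi> n)" "\<And>n x. \<bar>\<phi> n x\<bar> \<le> 1"
    "\<And>x. x \<in> cell D \<Longrightarrow> (\<lambda>n. \<phi> n x) \<longlonglongrightarrow> indicator (box c e) x"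
proof -
  \<comment> \<open>The bound holds for every \<open>g\<close>, smoothness for smooth
    \<open>g\<close>, and the limit depends only on where each \<open>g i\<close> is positive; so
    the two kinds of domain differ just in the choice of \<open>g\<close>.\<close>
  define \<psi> where "\<psi> g n x = (flat 1 (real n * g 1 x) * flat 1 (real n * g 2 x) :: real)"
    for g :: "2 \<Rightarrow> real^2 \<Rightarrow> real" and n :: nat and x :: "real^2"
  have bounds: "\<bar>\<psi> g n x\<bar> \<le> 1" for g n x
    using mult_mono[OF flat_1_bounds(2) flat_1_bounds(2), of "real n * g 1 x" "real n * g 2 x"]
    by (simp add: \<psi>_def abs_mult flat_1_bounds mult.commute)
  have sm: "smooth (\<psi> g n)" if "\<And>i. smooth (g i)" for g n
    unfolding \<psi>_def by (intro smooth_mult smooth_flat smooth_const that)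
  have lim: "(\<lambda>n. \<psi> g n x) \<longlonglongrightarrow> indicator (box c e) x"
    if "\<And>i. g i x > 0 \<longleftrightarrow> c $ i < x $ i \<and> x $ i < e $ i" for g x
  proof -
    have "(\<lambda>n. \<psi> g n x) \<longlonglongrightarrow> (if g 1 x > 0 then 1 else 0) * (if g 2 x > 0 then 1 else 0)"
      unfolding \<psi>_def by (intro tendsto_mult flat_1_scaled_tendsto)
    then show ?thesis
      by (simp add: that indicator_def mem_box_cart forall_2) (auto split: if_splits)
  qed
  have ce: "c $ i < e $ i" for i
    using ne unfolding interval_ne_empty_cart by blast
  show thesis
  proof (cases D)
    case (Periodic a b)
    define g where "g i x = cos (2 * pi / (b $ i - a $ i) * (x $ i - (c $ i + e $ i) / 2))
      - cos (pi * (e $ i - c $ i) / (b $ i - a $ i))" for i and x :: "real^2"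
    have ab: "a $ i < b $ i" for i using adm Periodic by simp
    have per: "g i (x + axis j (b $ j - a $ j)) = g i x" for i j x
    proof (cases "i = j")
      case True
      have "2 * pi / (b $ i - a $ i) * (x $ i + (b $ i - a $ i) - (c $ i + e $ i) / 2) =
          2 * pi / (b $ i - a $ i) * (x $ i - (c $ i + e $ i) / 2) + 2 * pi"
        using ab[of i] by (simp add: divide_simps) (simp add: algebra_simps)
      then show ?thesis using True by (simp add: g_def axis_def)
    qed (simp add: g_def axis_def)
    have sub': "a $ i \<le> c $ i \<and> e $ i \<le> b $ i" for i
    proof -
      have "c \<in> cbox c e" "e \<in> cbox c e" using ce by (auto simp: mem_box_cart less_imp_le)
      then have "c \<in> box a b" "e \<in> box a b" using sub Periodic by auto
      then show ?thesis by (simp add: mem_box_cart less_imp_le)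
    qed
    show thesis
    proof (rule that[of "\<psi> g"])
      show "test_fun D (\<psi> g n)" for n
      proof -
        have "smooth (g i)" for i
          unfolding g_def by (intro smooth_diff smooth_cos smooth_mult smooth_const smooth_component)
        then have "smooth (\<psi> g n)" by (rule sm)
        moreover have "\<psi> g n (x + axis j (b $ j - a $ j)) = \<psi> g n x" for x j
          by (simp add: \<psi>_def per)
        ultimately show ?thesis by (simp add: Periodic)
      qed
      show "(\<lambda>n. \<psi> g n x) \<longlonglongrightarrow> indicator (box c e) x" if "x \<in> cell D" for x
      proof (rule lim)
        show "g i x > 0 \<longleftrightarrow> c $ i < x $ i \<and> x $ i < e $ i" for i
          unfolding g_def using that sub'[of i] ce[of i]
          by (intro periodic_bump_pos_iff) (auto simp: Periodic mem_box_cart)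
      qed
    qed (rule bounds)
  next
    case (Homogeneous \<Omega>)
    define g where "g i x = (x $ i - c $ i) * (e $ i - x $ i)" for i and x :: "real^2"
    have g: "g i x > 0 \<longleftrightarrow> c $ i < x $ i \<and> x $ i < e $ i" for i x
      using ce[of i] by (auto simp: g_def zero_less_mult_iff)
    have supp: "closure {x. \<psi> g n x \<noteq> 0} \<subseteq> cbox c e" for n
    proof (rule closure_minimal)
      show "{x. \<psi> g n x \<noteq> 0} \<subseteq> cbox c e"
      proof
        fix x assume "x \<in> {x. \<psi> g n x \<noteq> 0}"
        then have "g 1 x > 0" "g 2 x > 0"
          by (auto simp: \<psi>_def flat_1_eq_0_iff mult_le_0_iff not_le zero_less_mult_iff)
        then show "x \<in> cbox c e"
          by (simp add: g mem_box_cart forall_2 less_imp_le)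
      qed
    qed (rule closed_cbox)
    show thesis
    proof (rule that[of "\<psi> g"])
      show "test_fun D (\<psi> g n)" for n
      proof -
        have "smooth (g i)" for i
          unfolding g_def by (intro smooth_mult smooth_diff smooth_const smooth_component)
        then have "smooth (\<psi> g n)" by (rule sm)
        moreover have "compact (closure {x. \<psi> g n x \<noteq> 0})"
          using compact_Int_closed[OF compact_cbox closed_closure, of c e "{x. \<psi> g n x \<noteq> 0}"] supp[of n]
          by (simp add: Int_absorb1)
        moreover have "closure {x. \<psi> g n x \<noteq> 0} \<subseteq> \<Omega>"
          using supp[of n] sub Homogeneous by (metis cell.simps(2) subset_trans)
        ultimately show ?thesis by (simp add: Homogeneous)
      qed
      show "(\<lambda>n. \<psi> g n x) \<longlonglongrightarrow> indicator (box c e) x" for x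
        by (rule lim) (rule g)
    qed (rule bounds)
  qed
qed

text \<open>Box indicators are pointwise limits on the cell of test functions bounded by 1, so
  dominated convergence with majorant |f| carries orthogonality over to boxes.\<close>

lemma test_fun_orthogonal_imp_AE_zero:
  assumes adm: "admissible_domain D" and f: "integrable (dmeas D) f"
    and orth: "\<And>\<phi>. test_fun D \<phi> \<Longrightarrow> (LINT x|dmeas D. f x * \<phi> x) = 0"
  shows "AE x in dmeas D. f x = 0"
proof (rule AE_zero_on_open[OF open_cell[OF adm] f])
  fix c e :: "real^2" assume ce: "cbox c e \<subseteq> cell D" "box c e \<noteq> {}"
  obtain \<phi> where \<phi>: "\<And>n. test_fun D (\<phi> n)" "\<And>n x. \<bar>\<phi> n x\<bar> \<le> 1"
    "\<And>x. x \<in> cell D \<Longrightarrow> (\<lambda>n. \<phi> n x) \<longlonglongrightarrow> indicator (box c e) x"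
    using box_approximation[OF adm ce] by metis
  have fm: "f \<in> borel_measurable (dmeas D)" using f by simp
  have \<phi>m: "\<phi> n \<in> borel_measurable (dmeas D)" for n
  proof -
    have "smooth (\<phi> n)" using \<phi>(1)[of n] by (cases D) auto
    then have "\<phi> n \<in> borel_measurable borel"
      by (intro borel_measurable_continuous_onI smooth_continuous)
    then show ?thesis by (intro measurable_restrict_space1 measurable_completion) simp
  qed
  have "(\<lambda>n. LINT x|dmeas D. f x * \<phi> n x) \<longlonglongrightarrow> (LINT x|dmeas D. f x * indicator (box c e) x)"
  proof (rule integral_dominated_convergence[where w = "\<lambda>x. \<bar>f x\<bar>"])
    show "AE x in dmeas D. (\<lambda>n. f x * \<phi> n x) \<longlonglongrightarrow> f x * indicator (box c e) x"
      using \<phi>(3) by (intro AE_I2 tendsto_mult tendsto_const) simp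
    show "AE x in dmeas D. norm (f x * \<phi> n x) \<le> \<bar>f x\<bar>" for n
      using \<phi>(2) by (intro AE_I2) (simp add: abs_mult mult_left_le)
    have "indicator (box c e) \<in> borel_measurable (dmeas D)"
      by (intro measurable_restrict_space1 borel_measurable_indicator) simp
    then show "(\<lambda>x. f x * indicator (box c e) x) \<in> borel_measurable (dmeas D)"
      using fm by (intro borel_measurable_times)
    show "(\<lambda>x. f x * \<phi> n x) \<in> borel_measurable (dmeas D)" for n
      using fm \<phi>m by (rule borel_measurable_times)
  qed (use f in simp)
  then show "(LINT x|dmeas D. indicator (box c e) x * f x) = 0"
    by (simp add: orth[OF \<phi>(1)] LIMSEQ_const_iff mult.commute)
qed

subsection \<open>The semi-inner product on \<open>L\<^sup>2\<close>\<close>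

text \<open>The Cauchy-Schwarz inequality and 2ab \<le> a^2 + b^2 supply the integrable
  majorant.\<close>

lemma integrable_inner_square:
  fixes f g :: "'a \<Rightarrow> 'b::euclidean_space"
  assumes "f \<in> borel_measurable M" "g \<in> borel_measurable M"
    and "integrable M (\<lambda>x. (norm (f x))\<^sup>2)" "integrable M (\<lambda>x. (norm (g x))\<^sup>2)"
  shows "integrable M (\<lambda>x. f x \<bullet> g x)"
proof (rule Bochner_Integration.integrable_bound)
  show "integrable M (\<lambda>x. (norm (f x))\<^sup>2 + (norm (g x))\<^sup>2)"
    using assms by simp
  show "(\<lambda>x. f x \<bullet> g x) \<in> borel_measurable M"
    using assms by simp
  have "norm (f x \<bullet> g x) \<le> norm ((norm (f x))\<^sup>2 + (norm (g x))\<^sup>2)" for x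
  proof -
    have "\<bar>f x \<bullet> g x\<bar> \<le> norm (f x) * norm (g x)" by (rule Cauchy_Schwarz_ineq2)
    also have "\<dots> \<le> 2 * norm (f x) * norm (g x)" by simp
    also have "\<dots> \<le> (norm (f x))\<^sup>2 + (norm (g x))\<^sup>2" by (rule sum_squares_bound)
    finally show ?thesis by simp
  qed
  then show "AE x in M. norm (f x \<bullet> g x) \<le> norm ((norm (f x))\<^sup>2 + (norm (g x))\<^sup>2)"
    by simp
qed

lemma L2_inner_integrable:
  "f \<in> L2 D \<Longrightarrow> g \<in> L2 D \<Longrightarrow> integrable (dmeas D) (\<lambda>x. f x \<bullet> g x)"
  unfolding L2_def by (intro integrable_inner_square) auto

lemma L2_add:
  assumes "f \<in> L2 D" "g \<in> L2 D" shows "(\<lambda>x. f x + g x) \<in> L2 D"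
proof -
  have "integrable (dmeas D) (\<lambda>x. f x \<bullet> f x + 2 * (f x \<bullet> g x) + g x \<bullet> g x)"
    using assms
    by (intro Bochner_Integration.integrable_add integrable_mult_right L2_inner_integrable)
  then have "integrable (dmeas D) (\<lambda>x. (norm (f x + g x))\<^sup>2)"
    by (simp add: power2_norm_eq_inner inner_add_left inner_add_right inner_commute algebra_simps)
  moreover have "periodic_on D (\<lambda>x. f x + g x)"
    using assms by (cases D) (auto simp: L2_def)
  ultimately show ?thesis
    using assms unfolding L2_def by (simp add: borel_measurable_add)
qed

lemma L2_scaleR:
  assumes "f \<in> L2 D" shows "(\<lambda>x. c *\<^sub>R f x) \<in> L2 D"
proof -
  have "periodic_on D (\<lambda>x. c *\<^sub>R f x)"
    using assms by (cases D) (auto simp: L2_def)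
  then show ?thesis
    using assms unfolding L2_def by (simp add: power_mult_distrib borel_measurable_scaleR)
qed

lemma L2_diff: "f \<in> L2 D \<Longrightarrow> g \<in> L2 D \<Longrightarrow> (\<lambda>x. f x - g x) \<in> L2 D"
  using L2_add[OF _ L2_scaleR[of _ D "-1"], of f g] by simp

lemma L2_zero: "(\<lambda>x. 0) \<in> L2 D"
  by (cases D) (auto simp: L2_def)

lemma L2_inner_add:
  assumes "f \<in> L2 D" "g \<in> L2 D" "h \<in> L2 D"
  shows "L2_inner D (\<lambda>x. f x + g x) h = L2_inner D f h + L2_inner D g h"
  using assms by (simp add: L2_inner_def inner_add_left L2_inner_integrable)

lemma L2_inner_diff:
  assumes "f \<in> L2 D" "g \<in> L2 D" "h \<in> L2 D"
  shows "L2_inner D (\<lambda>x. f x - g x) h = L2_inner D f h - L2_inner D g h"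
  using assms by (simp add: L2_inner_def inner_diff_left L2_inner_integrable)

lemma L2_inner_scaleR: "L2_inner D (\<lambda>x. c *\<^sub>R f x) h = c * L2_inner D f h"
  by (simp add: L2_inner_def)

lemma L2_inner_commute: "L2_inner D f g = L2_inner D g f"
  by (simp add: L2_inner_def inner_commute)

lemma L2_inner_self_nonneg: "L2_inner D f f \<ge> 0"
  unfolding L2_inner_def by (rule integral_nonneg_AE) simp

lemma L2_inner_self_eq_0_imp_AE:
  assumes "f \<in> L2 D" "L2_inner D f f = 0"
  shows "AE x in dmeas D. f x = 0"
proof -
  have "AE x in dmeas D. f x \<bullet> f x = 0"
    using integral_nonneg_eq_0_iff_AE[OF L2_inner_integrable[OF assms(1) assms(1)]] assms(2)
    by (simp add: L2_inner_def)
  then show ?thesis by simp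
qed

lemma L2_inner_cong_AE_right:
  assumes "f \<in> L2 D" "g \<in> L2 D" "h \<in> L2 D" "AE x in dmeas D. g x = h x"
  shows "L2_inner D f g = L2_inner D f h"
  unfolding L2_inner_def
proof (rule integral_cong_AE)
  show "AE x in dmeas D. f x \<bullet> g x = f x \<bullet> h x"
    using assms(4) by eventually_elim simp
qed (use assms in \<open>simp_all add: L2_inner_integrable borel_measurable_integrable\<close>)

lemma L2_inner_zero_right: "L2_inner D f (\<lambda>x. 0) = 0"
  by (simp add: L2_inner_def)

lemma L2_inner_square_le:
  assumes f: "f \<in> L2 D" and g: "g \<in> L2 D"
  shows "(L2_inner D f g)\<^sup>2 \<le> L2_inner D f f * L2_inner D g g"
proof (cases "L2_inner D g g = 0")
  \<comment> \<open>Division by (g, g) is impossible here, but then \<open>g\<close> is null and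
    pairs to 0 with everything in \<open>L2 D\<close>.\<close>
  case True
  then have "L2_inner D f g = 0"
    using L2_inner_cong_AE_right[OF f g L2_zero L2_inner_self_eq_0_imp_AE[OF g]]
    by (simp add: L2_inner_zero_right)
  then show ?thesis using True by simp
next
  case False
  \<comment> \<open>The coefficient for which f - k g is orthogonal to \<open>g\<close>; the
    inequality says that the square of this remainder is nonnegative.\<close>
  define k where "k = L2_inner D f g / L2_inner D g g"
  have kg: "(\<lambda>x. k *\<^sub>R g x) \<in> L2 D" using g by (rule L2_scaleR)
  have h: "(\<lambda>x. f x - k *\<^sub>R g x) \<in> L2 D" using f kg by (rule L2_diff)
  have "0 \<le> L2_inner D (\<lambda>x. f x - k *\<^sub>R g x) (\<lambda>x. f x - k *\<^sub>R g x)"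
    by (rule L2_inner_self_nonneg)
  also have "\<dots> = L2_inner D f (\<lambda>x. f x - k *\<^sub>R g x) - k * L2_inner D g (\<lambda>x. f x - k *\<^sub>R g x)"
    by (simp add: L2_inner_diff[OF f kg h] L2_inner_scaleR)
  also have "\<dots> = L2_inner D (\<lambda>x. f x - k *\<^sub>R g x) f - k * L2_inner D (\<lambda>x. f x - k *\<^sub>R g x) g"
    by (simp only: L2_inner_commute)
  also have "\<dots> = L2_inner D f f - (L2_inner D f g)\<^sup>2 / L2_inner D g g"
    using False
    by (simp add: L2_inner_diff[OF f kg f] L2_inner_diff[OF f kg g] L2_inner_scaleR
        L2_inner_commute[of D g f]) (simp add: k_def power2_eq_square)
  finally show ?thesis
    using False L2_inner_self_nonneg[of D g] by (simp add: divide_simps)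
qed

lemma L2_inner_abs_le:
  assumes "f \<in> L2 D" "g \<in> L2 D"
  shows "\<bar>L2_inner D f g\<bar> \<le> L2_norm D f * L2_norm D g"
  using real_sqrt_le_mono[OF L2_inner_square_le[OF assms]]
  by (simp add: L2_norm_def real_sqrt_mult)

subsection \<open>Weak divergence\<close>

lemma test_fun_smooth: "test_fun D \<phi> \<Longrightarrow> smooth \<phi>"
  by (cases D) auto

text \<open>The closure of the cell is compact, so \<open>G\<close> is bounded on the cell, which
  has finite measure.\<close>

lemma continuous_square_integrable:
  fixes G :: "real^2 \<Rightarrow> 'b::euclidean_space"
  assumes adm: "admissible_domain D" and G: "continuous_on UNIV G"
  shows "G \<in> borel_measurable (dmeas D)" "integrable (dmeas D) (\<lambda>x. (norm (G x))\<^sup>2)"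
proof -
  have "G \<in> borel_measurable borel"
    using G by (rule borel_measurable_continuous_onI)
  then show m: "G \<in> borel_measurable (dmeas D)"
    by (intro measurable_restrict_space1 measurable_completion) simp
  have "compact (G ` closure (cell D))"
    using bounded_cell[OF adm] G
    by (intro compact_continuous_image) (auto simp: compact_closure intro: continuous_on_subset)
  then obtain C where C: "\<And>x. x \<in> cell D \<Longrightarrow> norm (G x) \<le> C"
    using compact_imp_bounded bounded_iff closure_subset by (metis image_eqI subsetD)
  interpret finite_measure "dmeas D" using adm by (rule finite_measure_dmeas)
  show "integrable (dmeas D) (\<lambda>x. (norm (G x))\<^sup>2)"
    using C m by (intro integrable_const_bound[where B = "C\<^sup>2"] AE_I2) (auto intro: power_mono)
qed

lemma integrable_inner_gradient:
  assumes "admissible_domain D" "v \<in> L2 D" "test_fun D \<phi>"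
  shows "integrable (dmeas D) (\<lambda>x. v x \<bullet> (\<chi> i. pd i \<phi> x))"
proof -
  have "continuous_on UNIV (\<lambda>x. \<chi> i. pd i \<phi> x)"
    using assms(3)
    by (intro continuous_on_vec_lambda smooth_continuous smooth_pd) (rule test_fun_smooth)
  from continuous_square_integrable[OF assms(1) this] show ?thesis
    using assms(2) unfolding L2_def by (intro integrable_inner_square) auto
qed

lemma integrable_mult_test_fun:
  assumes "admissible_domain D" "d \<in> L2 D" "test_fun D \<phi>"
  shows "integrable (dmeas D) (\<lambda>x. d x * \<phi> x)"
proof -
  have "integrable (dmeas D) (\<lambda>x. d x \<bullet> \<phi> x)"
    using continuous_square_integrable[OF assms(1) smooth_continuous[OF test_fun_smooth[OF assms(3)]]]
      assms(2) unfolding L2_def by (intro integrable_inner_square) auto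
  then show ?thesis by simp
qed

text \<open>The difference of two weak divergences is orthogonal to all test functions. It is
  integrable because the measure is finite: pair it with the constant 1.\<close>

lemma has_weak_div_unique:
  assumes adm: "admissible_domain D" and d: "has_weak_div D v d" "has_weak_div D v d'"
  shows "AE x in dmeas D. d x = d' x"
proof -
  have L: "d \<in> L2 D" "d' \<in> L2 D" using d by (auto simp: has_weak_div_def)
  interpret finite_measure "dmeas D" using adm by (rule finite_measure_dmeas)
  have "integrable (dmeas D) (\<lambda>x. (d x - d' x) \<bullet> 1)"
    using L2_diff[OF L] unfolding L2_def by (intro integrable_inner_square) auto
  moreover have "(LINT x|dmeas D. (d x - d' x) * \<phi> x) = 0" if "test_fun D \<phi>" for \<phi>
    using d that integrable_mult_test_fun[OF adm _ that] L
    by (simp add: has_weak_div_def left_diff_distrib)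
  ultimately have "AE x in dmeas D. d x - d' x = 0"
    by (intro test_fun_orthogonal_imp_AE_zero[OF adm]) simp
  then show ?thesis by simp
qed

lemma has_weak_div_lincomb:
  assumes adm: "admissible_domain D" and v: "has_weak_div D v d" and w: "has_weak_div D w e"
  shows "has_weak_div D (\<lambda>x. a *\<^sub>R v x + b *\<^sub>R w x) (\<lambda>x. a *\<^sub>R d x + b *\<^sub>R e x)"
proof -
  have L: "v \<in> L2 D" "w \<in> L2 D" "d \<in> L2 D" "e \<in> L2 D"
    using v w by (auto simp: has_weak_div_def)
  have "(LINT x|dmeas D. (a *\<^sub>R v x + b *\<^sub>R w x) \<bullet> (\<chi> i. pd i \<phi> x))
      = - (LINT x|dmeas D. (a *\<^sub>R d x + b *\<^sub>R e x) * \<phi> x)" if \<phi>: "test_fun D \<phi>" for \<phi>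
  proof -
    have "(LINT x|dmeas D. (a *\<^sub>R v x + b *\<^sub>R w x) \<bullet> (\<chi> i. pd i \<phi> x))
      = a * (LINT x|dmeas D. v x \<bullet> (\<chi> i. pd i \<phi> x)) + b * (LINT x|dmeas D. w x \<bullet> (\<chi> i. pd i \<phi> x))"
      using integrable_inner_gradient[OF adm _ \<phi>] L by (simp add: inner_add_left)
    moreover have "(LINT x|dmeas D. (a *\<^sub>R d x + b *\<^sub>R e x) * \<phi> x)
      = a * (LINT x|dmeas D. d x * \<phi> x) + b * (LINT x|dmeas D. e x * \<phi> x)"
      using integrable_mult_test_fun[OF adm _ \<phi>] L by (simp add: distrib_right mult.assoc)
    ultimately show ?thesis using v w \<phi> by (simp add: has_weak_div_def)
  qed
  then show ?thesis
    using L by (simp only: has_weak_div_def L2_add L2_scaleR simp_thms) blast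
qed

lemma has_weak_div_AE_zero:
  assumes "v \<in> L2 D" "AE x in dmeas D. v x = 0"
  shows "has_weak_div D v (\<lambda>x. 0)"
proof -
  have "(LINT x|dmeas D. v x \<bullet> w x) = 0" for w
    by (rule integral_eq_zero_AE) (use assms(2) in eventually_elim, simp)
  then show ?thesis using assms(1) L2_zero by (simp add: has_weak_div_def)
qed

lemma has_weak_div_weak_div: "v \<in> Hdiv D \<Longrightarrow> has_weak_div D v (weak_div D v)"
  unfolding Hdiv_def weak_div_def by (simp add: someI_ex)

lemma Hdiv_L2: "v \<in> Hdiv D \<Longrightarrow> v \<in> L2 D"
  and weak_div_L2: "v \<in> Hdiv D \<Longrightarrow> weak_div D v \<in> L2 D"
  using has_weak_div_weak_div by (auto simp: has_weak_div_def)

lemma V1_subset_Hdiv: "V1 D \<subseteq> Hdiv D"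
  by (cases D) auto

text \<open>\<open>weak_div\<close> is a choice and so need not be linear pointwise. Uniqueness
  almost everywhere makes it linear once it is paired with \<open>q\<close>.\<close>

lemma L2_inner_weak_div_lincomb:
  assumes adm: "admissible_domain D" and q: "q \<in> L2 D" and v: "v \<in> Hdiv D" and w: "w \<in> Hdiv D"
  shows "L2_inner D q (weak_div D (\<lambda>x. a *\<^sub>R v x + b *\<^sub>R w x))
    = a * L2_inner D q (weak_div D v) + b * L2_inner D q (weak_div D w)"
proof -
  let ?d = "weak_div D v" and ?e = "weak_div D w" and ?u = "\<lambda>x. a *\<^sub>R v x + b *\<^sub>R w x"
  have d: "has_weak_div D ?u (\<lambda>x. a *\<^sub>R ?d x + b *\<^sub>R ?e x)"
    using v w by (intro has_weak_div_lincomb[OF adm] has_weak_div_weak_div)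
  then have u: "?u \<in> Hdiv D" by (auto simp: Hdiv_def)
  have L: "?d \<in> L2 D" "?e \<in> L2 D" using v w by (simp_all add: weak_div_L2)
  have "L2_inner D q (weak_div D ?u) = L2_inner D q (\<lambda>x. a *\<^sub>R ?d x + b *\<^sub>R ?e x)"
    using u d q has_weak_div_unique[OF adm has_weak_div_weak_div[OF u] d]
    by (intro L2_inner_cong_AE_right weak_div_L2) (auto simp: has_weak_div_def)
  also have "\<dots> = L2_inner D (\<lambda>x. a *\<^sub>R ?d x + b *\<^sub>R ?e x) q"
    by (rule L2_inner_commute)
  also have "\<dots> = a * L2_inner D ?d q + b * L2_inner D ?e q"
    by (simp only: L2_inner_add[OF L2_scaleR[OF L(1)] L2_scaleR[OF L(2)] q] L2_inner_scaleR)
  finally show ?thesis by (simp only: L2_inner_commute[of D q])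
qed

text \<open>The zero function is a weak divergence of a null field, and uniqueness does the rest.
  This is the compatibility with null functions that the Riesz representation on a semidefinite
  space demands.\<close>

lemma L2_inner_weak_div_AE_zero:
  assumes adm: "admissible_domain D" and q: "q \<in> L2 D" and v: "v \<in> Hdiv D"
    and "AE x in dmeas D. v x = 0"
  shows "L2_inner D q (weak_div D v) = 0"
  using L2_inner_cong_AE_right[OF q weak_div_L2[OF v] L2_zero
      has_weak_div_unique[OF adm has_weak_div_weak_div[OF v] has_weak_div_AE_zero[OF Hdiv_L2[OF v]]]]
    assms(4) by (simp add: L2_inner_zero_right)

subsection \<open>The discrete operators\<close>

definition lin_span :: "('a \<Rightarrow> 'b::real_vector) set \<Rightarrow> ('a \<Rightarrow> 'b) set" where
  "lin_span B = {f. \<exists>c. f = (\<lambda>x. \<Sum>\<beta>\<in>B. c \<beta> *\<^sub>R \<beta> x)}"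

lemma lin_span_lincomb:
  assumes "f \<in> lin_span B" "g \<in> lin_span B"
  shows "(\<lambda>x. a *\<^sub>R f x + b *\<^sub>R g x) \<in> lin_span B"
proof -
  obtain c d where "f = (\<lambda>x. \<Sum>\<beta>\<in>B. c \<beta> *\<^sub>R \<beta> x)" "g = (\<lambda>x. \<Sum>\<beta>\<in>B. d \<beta> *\<^sub>R \<beta> x)"
    using assms by (auto simp: lin_span_def)
  then have "(\<lambda>x. a *\<^sub>R f x + b *\<^sub>R g x) = (\<lambda>x. \<Sum>\<beta>\<in>B. (a * c \<beta> + b * d \<beta>) *\<^sub>R \<beta> x)"
    by (simp add: scaleR_right.sum scaleR_sum_right scaleR_add_left sum.distrib)
  then show ?thesis
    unfolding lin_span_def by (intro CollectI exI[of _ "\<lambda>\<beta>. a * c \<beta> + b * d \<beta>"])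
qed

lemma lin_span_insert:
  assumes "finite B" "\<beta> \<notin> B"
  shows "f \<in> lin_span (insert \<beta> B) \<longleftrightarrow> (\<exists>a. \<exists>g\<in>lin_span B. f = (\<lambda>x. a *\<^sub>R \<beta> x + g x))"
proof
  assume "f \<in> lin_span (insert \<beta> B)"
  then obtain c where "f = (\<lambda>x. c \<beta> *\<^sub>R \<beta> x + (\<Sum>\<gamma>\<in>B. c \<gamma> *\<^sub>R \<gamma> x))"
    using assms by (auto simp: lin_span_def)
  then show "\<exists>a. \<exists>g\<in>lin_span B. f = (\<lambda>x. a *\<^sub>R \<beta> x + g x)"
    by (auto simp: lin_span_def)
next
  assume "\<exists>a. \<exists>g\<in>lin_span B. f = (\<lambda>x. a *\<^sub>R \<beta> x + g x)"
  then obtain a c where f: "f = (\<lambda>x. a *\<^sub>R \<beta> x + (\<Sum>\<gamma>\<in>B. c \<gamma> *\<^sub>R \<gamma> x))"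
    by (auto simp: lin_span_def)
  have "(\<Sum>\<gamma>\<in>B. (c(\<beta> := a)) \<gamma> *\<^sub>R \<gamma> x) = (\<Sum>\<gamma>\<in>B. c \<gamma> *\<^sub>R \<gamma> x)" for x
    using assms by (intro sum.cong) auto
  then have "f = (\<lambda>x. \<Sum>\<gamma>\<in>insert \<beta> B. (c(\<beta> := a)) \<gamma> *\<^sub>R \<gamma> x)"
    using assms f by simp
  then show "f \<in> lin_span (insert \<beta> B)"
    unfolding lin_span_def by blast
qed

lemma lin_span_empty: "lin_span {} = {\<lambda>x. 0}"
  by (auto simp: lin_span_def)

lemma lin_span_zero: "(\<lambda>x. 0) \<in> lin_span B"
  unfolding lin_span_def by (auto intro!: exI[of _ "\<lambda>_. 0"])

lemma lin_span_superset:
  assumes "finite B" "\<beta> \<in> B" shows "\<beta> \<in> lin_span B"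
proof -
  have eq: "\<beta> = (\<lambda>x. \<Sum>\<gamma>\<in>B. (if \<gamma> = \<beta> then 1 else 0) *\<^sub>R \<gamma> x)"
  proof
    fix x
    have "(\<Sum>\<gamma>\<in>B. (if \<gamma> = \<beta> then 1 else 0) *\<^sub>R \<gamma> x) = (\<Sum>\<gamma>\<in>B. if \<gamma> = \<beta> then \<gamma> x else 0)"
      by (intro sum.cong) auto
    then show "\<beta> x = (\<Sum>\<gamma>\<in>B. (if \<gamma> = \<beta> then 1 else 0) *\<^sub>R \<gamma> x)"
      using assms by (simp add: sum.delta)
  qed
  show ?thesis
    unfolding lin_span_def by (intro CollectI exI[of _ "\<lambda>\<gamma>. if \<gamma> = \<beta> then 1 else 0"]) (rule eq)
qed

text \<open>
  \<open>L2_inner\<close> is only semidefinite on functions, so \<open>\<phi>\<close> has to vanish on null functions. The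
  induction adds to the representer \<open>g\<close> on \<open>lin_span B\<close> the right multiple of the component \<open>r\<close> of
  \<open>\<beta>\<close> orthogonal to \<open>lin_span B\<close>; if \<open>r\<close> is null, that multiple is \<open>\<phi> r / 0 = 0\<close>.
\<close>

lemma L2_riesz_lin_span:
  assumes "finite B" "B \<subseteq> S" and S: "S \<subseteq> L2 D" "(\<lambda>x. 0) \<in> S"
    and closed: "\<And>f g a b. f \<in> S \<Longrightarrow> g \<in> S \<Longrightarrow> (\<lambda>x. a *\<^sub>R f x + b *\<^sub>R g x) \<in> S"
    and "\<And>f g a b. f \<in> S \<Longrightarrow> g \<in> S \<Longrightarrow> \<phi> (\<lambda>x. a *\<^sub>R f x + b *\<^sub>R g x) = a * \<phi> f + b * \<phi> g"
    and "\<And>f. f \<in> S \<Longrightarrow> L2_inner D f f = 0 \<Longrightarrow> \<phi> f = (0::real)"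
  shows "\<exists>g\<in>lin_span B. g \<in> S \<and> (\<forall>v\<in>lin_span B. v \<in> S \<and> L2_inner D g v = \<phi> v)"
  using assms(1,2,6,7)
proof (induction B arbitrary: \<phi> rule: finite_induct)
  case empty
  have "\<phi> (\<lambda>x. 0) = 0"
    using empty(3)[OF S(2)] by (simp add: L2_inner_def)
  then show ?case using S(2) by (simp add: lin_span_empty L2_inner_def)
next
  case (insert \<beta> B)
  note lin = insert.prems(2) and null = insert.prems(3)
  have \<beta>: "\<beta> \<in> S" and BS: "B \<subseteq> S" using insert.prems(1) by auto
  have ip: "L2_inner D (\<lambda>x. a *\<^sub>R f x + b *\<^sub>R g x) h = a * L2_inner D f h + b * L2_inner D g h"
    if "f \<in> S" "g \<in> S" "h \<in> S" for f g h a b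
  proof -
    have "f \<in> L2 D" "g \<in> L2 D" "h \<in> L2 D" using that S by auto
    then show ?thesis by (simp add: L2_inner_add L2_scaleR L2_inner_scaleR)
  qed
  have ip': "L2_inner D h (\<lambda>x. a *\<^sub>R f x + b *\<^sub>R g x) = a * L2_inner D h f + b * L2_inner D h g"
    if "f \<in> S" "g \<in> S" "h \<in> S" for f g h a b
    using ip[OF that] by (simp only: L2_inner_commute)
  \<comment> \<open>Pairing with \<open>\<beta>\<close> is itself a functional that vanishes on null
    functions, by Cauchy-Schwarz. The induction hypothesis, available for every functional,
    represents it by \<open>p\<close>, an orthogonal projection of \<open>\<beta>\<close> to
    \<open>lin_span B\<close>.\<close>
  have "L2_inner D \<beta> f = 0" if "f \<in> S" "L2_inner D f f = 0" for f
    using L2_inner_square_le[of \<beta> D f] that \<beta> S by auto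
  then obtain p where p: "p \<in> lin_span B" "p \<in> S"
    and p_eq: "\<And>v. v \<in> lin_span B \<Longrightarrow> L2_inner D p v = L2_inner D \<beta> v"
    using insert.IH[OF BS, of "L2_inner D \<beta>"] ip' \<beta> by blast
  obtain g where g: "g \<in> lin_span B" "g \<in> S"
    and g_eq: "\<And>v. v \<in> lin_span B \<Longrightarrow> v \<in> S \<and> L2_inner D g v = \<phi> v"
  proof -
    have "\<exists>g\<in>lin_span B. g \<in> S \<and> (\<forall>v\<in>lin_span B. v \<in> S \<and> L2_inner D g v = \<phi> v)"
      by (rule insert.IH[OF BS]) (rule lin null, assumption+)+
    then show thesis using that by blast
  qed
  define r where "r = (\<lambda>x. 1 *\<^sub>R \<beta> x + (-1) *\<^sub>R p x)"
  have rS: "r \<in> S" unfolding r_def using \<beta> p(2) by (rule closed)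
  have r_orth: "L2_inner D r v = 0" if "v \<in> lin_span B" for v
    unfolding r_def using ip[OF \<beta> p(2), of v 1 "-1"] p_eq[OF that] g_eq[OF that] by simp
  define k where "k = \<phi> r / L2_inner D r r"
  have k: "k * L2_inner D r r = \<phi> r" using null[OF rS] by (auto simp: k_def)
  define G where "G = (\<lambda>x. k *\<^sub>R r x + 1 *\<^sub>R g x)"
  have GS: "G \<in> S" unfolding G_def using rS g(2) by (rule closed)
  have "G = (\<lambda>x. k *\<^sub>R \<beta> x + ((-k) *\<^sub>R p x + 1 *\<^sub>R g x))"
    by (auto simp: G_def r_def algebra_simps)
  then have "G \<in> lin_span (insert \<beta> B)"
    unfolding lin_span_insert[OF insert.hyps(1,2)]
    using lin_span_lincomb[OF p(1) g(1), of "-k" 1] by (intro exI bexI)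
  moreover have "v \<in> S \<and> L2_inner D G v = \<phi> v" if v: "v \<in> lin_span (insert \<beta> B)" for v
  proof -
    obtain a w where w: "w \<in> lin_span B" and v_eq: "v = (\<lambda>x. a *\<^sub>R \<beta> x + w x)"
      using v insert.hyps by (auto simp: lin_span_insert)
    \<comment> \<open>Replacing \<open>\<beta>\<close> by r + p moves the part along
      \<open>p\<close> into the span of \<open>B\<close>, so \<open>v\<close> splits into orthogonal
      parts a r and \<open>w'\<close>.\<close>
    define w' where "w' = (\<lambda>x. a *\<^sub>R p x + 1 *\<^sub>R w x)"
    have w': "w' \<in> lin_span B" unfolding w'_def using p(1) w by (rule lin_span_lincomb)
    then have w'S: "w' \<in> S" using g_eq by blast
    have v': "v = (\<lambda>x. a *\<^sub>R r x + 1 *\<^sub>R w' x)"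
      by (auto simp: v_eq w'_def r_def algebra_simps)
    have vS: "v \<in> S" unfolding v' using rS w'S by (rule closed)
    have "L2_inner D G v = k * L2_inner D r v + L2_inner D g v"
      unfolding G_def using ip[OF rS g(2) vS, of k 1] by simp
    also have "L2_inner D r v = a * L2_inner D r r"
      unfolding v' using ip'[OF rS w'S rS, of a 1] r_orth[OF w'] by simp
    also have "L2_inner D g v = \<phi> w'"
      unfolding v' using ip'[OF rS w'S g(2), of a 1] r_orth[OF g(1)] g_eq[OF w']
      by (simp add: L2_inner_commute[of D g r])
    finally have "L2_inner D G v = a * \<phi> r + \<phi> w'"
      using k by (simp add: algebra_simps)
    also have "\<dots> = \<phi> v" unfolding v' using lin[OF rS w'S, of a 1] by simp
    finally show ?thesis using vS by simp
  qed
  ultimately show ?case using GS by blast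
qed

section \<open>The discrete gradient and the convection form\<close>

lemma discrete_subspace_lin_span:
  assumes "discrete_subspace D V Vh"
  obtains B where "finite B" "Vh = lin_span B"
  using assms unfolding discrete_subspace_def fin_dim_fun_space_def lin_span_def by blast

text \<open>The Riesz lemma, with \<open>V1h\<close> as both the span and the ambient space
  \<open>S\<close>, represents minus the pairing of \<open>q\<close> with the weak divergence.
  Existence passes the two properties to the chosen function.\<close>

lemma grad_h_properties:
  assumes adm: "admissible_domain D" and V1h: "discrete_subspace D (V1 D) V1h" and q: "q \<in> L2 D"
  shows "grad_h D V1h q \<in> V1h"
    and "\<And>v. v \<in> V1h \<Longrightarrow> L2_inner D (grad_h D V1h q) v = - L2_inner D q (weak_div D v)"
proof -
  obtain B where B: "finite B" "V1h = lin_span B"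
    using V1h by (rule discrete_subspace_lin_span)
  have H: "V1h \<subseteq> Hdiv D"
    using V1h V1_subset_Hdiv by (auto simp: discrete_subspace_def)
  have "\<exists>g\<in>lin_span B. g \<in> V1h \<and>
      (\<forall>v\<in>lin_span B. v \<in> V1h \<and> L2_inner D g v = - L2_inner D q (weak_div D v))"
  proof (rule L2_riesz_lin_span[OF B(1)])
    show "B \<subseteq> V1h" using B lin_span_superset by auto
    show "V1h \<subseteq> L2 D" using H Hdiv_L2 by auto
    show "(\<lambda>x. 0) \<in> V1h" unfolding B(2) by (rule lin_span_zero)
    show "(\<lambda>x. a *\<^sub>R f x + b *\<^sub>R g x) \<in> V1h" if "f \<in> V1h" "g \<in> V1h" for f g a b
      using that unfolding B(2) by (rule lin_span_lincomb)
    show "- L2_inner D q (weak_div D (\<lambda>x. a *\<^sub>R f x + b *\<^sub>R g x))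
        = a * - L2_inner D q (weak_div D f) + b * - L2_inner D q (weak_div D g)"
      if "f \<in> V1h" "g \<in> V1h" for f g a b
      using L2_inner_weak_div_lincomb[OF adm q subsetD[OF H that(1)] subsetD[OF H that(2)], of a b]
      by simp
    show "- L2_inner D q (weak_div D f) = 0" if "f \<in> V1h" "L2_inner D f f = 0" for f
      using L2_inner_weak_div_AE_zero[OF adm q, of f] L2_inner_self_eq_0_imp_AE[of f D] that H
        Hdiv_L2 by auto
  qed
  then have "\<exists>g. g \<in> V1h \<and> (\<forall>v\<in>V1h. L2_inner D g v = - L2_inner D q (weak_div D v))"
    using B(2) by blast
  from someI_ex[OF this]
  show "grad_h D V1h q \<in> V1h"
    "\<And>v. v \<in> V1h \<Longrightarrow> L2_inner D (grad_h D V1h q) v = - L2_inner D q (weak_div D v)"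
    unfolding grad_h_def by blast+
qed

text \<open>The expression under the projection is antisymmetric, hence 0 on the diagonal. The
  chosen projection of 0 may be a nonzero null function, so its defining orthogonality to
  \<open>V1h\<close> is used; membership of 0 in \<open>V1h\<close> ensures that a choice
  exists.\<close>

lemma s_h_self_orthogonal:
  assumes "(\<lambda>x. 0) \<in> V1h" "u \<in> V1h"
  shows "L2_inner D u (s_h D V1h V2h u u) = 0"
proof -
  define g where "g = L2_proj D V1h (\<lambda>x. 0)"
  have "\<exists>g. g \<in> V1h \<and> (\<forall>w\<in>V1h. L2_inner D (\<lambda>x. 0 - g x) w = 0)"
    using assms(1) by (intro exI[of _ "\<lambda>x. 0"]) (simp add: L2_inner_def)
  from someI_ex[OF this] have "L2_inner D (\<lambda>x. 0 - g x) u = 0"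
    using assms(2) unfolding g_def L2_proj_def by blast
  then have "L2_inner D u g = 0"
    using L2_inner_scaleR[of D "-1" g u] by (simp add: L2_inner_commute)
  moreover have "s_h D V1h V2h u u = (\<lambda>x. (1/2) *\<^sub>R g x)"
    by (simp add: s_h_def g_def)
  ultimately show ?thesis
    using L2_inner_scaleR[of D "1/2" g u] by (simp add: L2_inner_commute)
qed

subsection \<open>Differentiation in time\<close>

lemma L2_norm_tendsto_0_imp_inner_tendsto_0:
  assumes "((\<lambda>s. L2_norm D (f s)) \<longlongrightarrow> 0) F" "eventually (\<lambda>s. f s \<in> L2 D) F" "w \<in> L2 D"
  shows "((\<lambda>s. L2_inner D (f s) w) \<longlongrightarrow> 0) F"
proof (rule Lim_null_comparison)
  show "eventually (\<lambda>s. norm (L2_inner D (f s) w) \<le> L2_norm D (f s) * L2_norm D w) F"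
    using assms(2) by eventually_elim (simp add: L2_inner_abs_le assms(3))
  show "((\<lambda>s. L2_norm D (f s) * L2_norm D w) \<longlongrightarrow> 0) F"
    using tendsto_mult_left_zero[OF assms(1)] .
qed

lemma L2_norm_square: "(L2_norm D f)\<^sup>2 = L2_inner D f f"
  by (simp add: L2_norm_def L2_inner_self_nonneg)

text \<open>Write u(s) = u(t) + (s - t) (\<open>\<delta>\<close> s + du(t)), where
  \<open>\<delta>\<close> s is the error of the difference quotient and tends to 0 in norm.
  Expanding the inner products and bounding those with \<open>\<delta>\<close> by Cauchy-Schwarz
  gives both derivatives, one-sided at the ends of the interval.\<close>

lemma
  fixes u du :: "real \<Rightarrow> real^2 \<Rightarrow> 'b::euclidean_space"
  assumes u: "C1_in_time D T V u du" and V: "V \<subseteq> L2 D" and t: "t \<in> {0..T}"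
  shows C1_in_time_inner_has_derivative:
      "w \<in> L2 D \<Longrightarrow>
        ((\<lambda>s. L2_inner D (u s) w) has_real_derivative L2_inner D (du t) w) (at t within {0..T})"
    and C1_in_time_energy_has_derivative:
      "((\<lambda>s. (1/2) * L2_inner D (u s) (u s)) has_real_derivative L2_inner D (du t) (u t))
        (at t within {0..T})"
proof -
  let ?F = "at t within {0..T}"
  define \<delta> where "\<delta> s = (\<lambda>x. (u s x - u t x) /\<^sub>R (s - t) - du t x)" for s
  have uL: "u s \<in> L2 D" if "s \<in> {0..T}" for s
    using u V that by (auto simp: C1_in_time_def)
  have ut: "u t \<in> L2 D" and dut: "du t \<in> L2 D"
    using u V t by (auto simp: C1_in_time_def)
  have ev: "eventually (\<lambda>s. s \<in> {0..T} \<and> s \<noteq> t) ?F"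
    by (auto simp: eventually_at_filter)
  have \<delta>L: "\<delta> s \<in> L2 D" if "s \<in> {0..T}" for s
    unfolding \<delta>_def by (intro L2_diff L2_scaleR uL that ut dut)
  have ev\<delta>: "eventually (\<lambda>s. \<delta> s \<in> L2 D) ?F"
    using ev by eventually_elim (simp add: \<delta>L)
  have norm\<delta>: "((\<lambda>s. L2_norm D (\<delta> s)) \<longlongrightarrow> 0) ?F"
    using u t by (auto simp: C1_in_time_def \<delta>_def)
  have inner_u: "L2_inner D (u s) w = L2_inner D (u t) w + (s - t) * (L2_inner D (\<delta> s) w + L2_inner D (du t) w)"
    if "s \<in> {0..T}" "s \<noteq> t" "w \<in> L2 D" for s w
  proof -
    have "u s = (\<lambda>x. u t x + (s - t) *\<^sub>R (\<delta> s x + du t x))"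
      using that(2) by (simp add: \<delta>_def)
    then show ?thesis
      using that \<delta>L[OF that(1)] ut dut
      by (simp add: L2_inner_add L2_inner_scaleR L2_scaleR L2_add)
  qed
  {
    fix w :: "real^2 \<Rightarrow> 'b" assume w: "w \<in> L2 D"
    have "((\<lambda>s. L2_inner D (\<delta> s) w + L2_inner D (du t) w) \<longlongrightarrow> 0 + L2_inner D (du t) w) ?F"
      by (intro tendsto_add tendsto_const L2_norm_tendsto_0_imp_inner_tendsto_0 norm\<delta> ev\<delta> w)
    moreover have "eventually (\<lambda>s. L2_inner D (\<delta> s) w + L2_inner D (du t) w
        = (L2_inner D (u s) w - L2_inner D (u t) w) / (s - t)) ?F"
      using ev by eventually_elim (simp add: inner_u w)
    ultimately show "((\<lambda>s. L2_inner D (u s) w) has_real_derivative L2_inner D (du t) w) ?F"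
      unfolding has_field_derivative_iff by (auto dest: Lim_transform_eventually)
  }
  have \<delta>u: "((\<lambda>s. L2_inner D (\<delta> s) (u t)) \<longlongrightarrow> 0) ?F"
    and \<delta>du: "((\<lambda>s. L2_inner D (\<delta> s) (du t)) \<longlongrightarrow> 0) ?F"
    by (rule L2_norm_tendsto_0_imp_inner_tendsto_0[OF norm\<delta> ev\<delta>], rule ut dut)+
  have \<delta>\<delta>: "((\<lambda>s. L2_inner D (\<delta> s) (\<delta> s)) \<longlongrightarrow> 0) ?F"
    using tendsto_power[OF norm\<delta>, of 2] by (simp add: L2_norm_square)
  \<comment> \<open>This is the difference quotient of the energy: the factor after (s - t)/2 is the
    squared norm of \<open>\<delta>\<close> s + du(t), expanded, and stays bounded near t.\<close>
  have "((\<lambda>s. L2_inner D (\<delta> s) (u t) + L2_inner D (du t) (u t) + (1/2) * (s - t) *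
      (L2_inner D (\<delta> s) (\<delta> s) + 2 * L2_inner D (\<delta> s) (du t) + L2_inner D (du t) (du t)))
    \<longlongrightarrow> 0 + L2_inner D (du t) (u t) + (1/2) * (t - t) * (0 + 2 * 0 + L2_inner D (du t) (du t))) ?F"
    by (intro tendsto_intros \<delta>u \<delta>du \<delta>\<delta>)
  moreover have "eventually (\<lambda>s. L2_inner D (\<delta> s) (u t) + L2_inner D (du t) (u t) + (1/2) * (s - t) *
      (L2_inner D (\<delta> s) (\<delta> s) + 2 * L2_inner D (\<delta> s) (du t) + L2_inner D (du t) (du t))
    = ((1/2) * L2_inner D (u s) (u s) - (1/2) * L2_inner D (u t) (u t)) / (s - t)) ?F"
    using ev
  proof eventually_elim
    case (elim s)
    define h where "h = s - t"
    have s: "s \<in> {0..T}" "s \<noteq> t" and h: "h \<noteq> 0" using elim by (auto simp: h_def)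
    have C: "L2_inner D f (u s) = L2_inner D f (u t) + h * (L2_inner D f (\<delta> s) + L2_inner D f (du t))"
      if "f \<in> L2 D" for f
      using inner_u[OF s that] by (simp add: h_def L2_inner_commute)
    have "L2_inner D (u s) (u s) = L2_inner D (u t) (u t)
        + h * (L2_inner D (u t) (\<delta> s) + L2_inner D (u t) (du t))
        + h * (L2_inner D (\<delta> s) (u t) + h * (L2_inner D (\<delta> s) (\<delta> s) + L2_inner D (\<delta> s) (du t))
             + (L2_inner D (du t) (u t) + h * (L2_inner D (du t) (\<delta> s) + L2_inner D (du t) (du t))))"
      using inner_u[OF s uL[OF s(1)]] C[OF ut] C[OF dut] C[OF \<delta>L[OF s(1)]] by (simp add: h_def)
    then have "L2_inner D (u s) (u s) - L2_inner D (u t) (u t) = 2 * h * (L2_inner D (\<delta> s) (u t)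
        + L2_inner D (du t) (u t) + (1/2) * h *
        (L2_inner D (\<delta> s) (\<delta> s) + 2 * L2_inner D (\<delta> s) (du t) + L2_inner D (du t) (du t)))"
      by (simp add: L2_inner_commute[of D "u t" "\<delta> s"] L2_inner_commute[of D "u t" "du t"]
          L2_inner_commute[of D "du t" "\<delta> s"] algebra_simps)
    then show ?case
      using h unfolding h_def[symmetric] by (simp add: field_simps)
  qed
  ultimately show "((\<lambda>s. (1/2) * L2_inner D (u s) (u s)) has_real_derivative L2_inner D (du t) (u t)) ?F"
    unfolding has_field_derivative_iff by (auto dest: Lim_transform_eventually)
qed

section \<open>Conservation of the discrete energy\<close>

theorem proposition6:
  fixes D :: flow_domain
    and V0h :: "(real^2 \<Rightarrow> real) set"
    and V1h :: "(real^2 \<Rightarrow> real^2) set"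
    and V2h :: "(real^2 \<Rightarrow> real) set"
    and T :: real
    and u du :: "real \<Rightarrow> real^2 \<Rightarrow> real^2"
    and p :: "real \<Rightarrow> real^2 \<Rightarrow> real"
  assumes "admissible_domain D"
    and "conforming_complex D V0h V1h V2h"
    and "T > 0"
    and "C1_in_time D T V1h u du"
    and "\<And>t. t \<in> {0..T} \<Longrightarrow> p t \<in> V2h"
    and "ae_eq D (weak_div D (u 0)) (\<lambda>x. 0)"
    and "\<And>t v. t \<in> {0..T} \<Longrightarrow> v \<in> V1h \<Longrightarrow>
           L2_inner D (du t) v + L2_inner D (u t) (s_h D V1h V2h (u t) v)
             + L2_inner D (grad_h D V1h (p t)) v = 0"
    and "\<And>t q. t \<in> {0..T} \<Longrightarrow> q \<in> V2h \<Longrightarrow>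
           L2_inner D (u t) (s_h D V1h V2h (u t) (grad_h D V1h q))
             + L2_inner D (grad_h D V1h (p t)) (grad_h D V1h q) = 0"
  shows "\<forall>t \<in> {0..T}.
           ((\<lambda>s. LINT x|dmeas D. (1/2) * (norm (u s x))\<^sup>2) has_real_derivative 0)
             (at t within {0..T})"
proof
  fix t assume t: "t \<in> {0..T}"
  have dV1: "discrete_subspace D (V1 D) V1h" and V2L: "V2h \<subseteq> L2 D"
    using assms(2) by (auto simp: conforming_complex_def discrete_subspace_def V2_def)
  have V1H: "V1h \<subseteq> Hdiv D"
    using dV1 V1_subset_Hdiv by (auto simp: discrete_subspace_def)
  have V1L: "V1h \<subseteq> L2 D" using V1H Hdiv_L2 by auto
  have zero: "(\<lambda>x. 0) \<in> V1h"
    using discrete_subspace_lin_span[OF dV1] lin_span_zero by metis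
  have uV: "u s \<in> V1h" if "s \<in> {0..T}" for s
    using assms(4) that by (auto simp: C1_in_time_def)
  have T0: "0 \<in> {0..T}" using assms(3) by simp
  have pL: "p t \<in> L2 D" using assms(5)[OF t] V2L by auto
  let ?g = "grad_h D V1h (p t)"
  note g = grad_h_properties[OF assms(1) dV1 pL]
  have gL: "?g \<in> L2 D" using g(1) V1L by auto

  \<comment> \<open>The pressure is frozen at time \<open>t\<close> while \<open>s\<close> varies:
    at each time \<open>s\<close> both equations are tested with this one gradient, whose pairing
    with u(s) is therefore constant.\<close>
  have "\<exists>c. \<forall>s\<in>{0..T}. L2_inner D (u s) ?g = c"
  proof (rule has_field_derivative_zero_constant)
    fix s assume s: "s \<in> {0..T}"
    have "L2_inner D (du s) ?g = 0"
      using assms(7)[OF s g(1)] assms(8)[OF s assms(5)[OF t]] by linarith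
    then show "((\<lambda>s. L2_inner D (u s) ?g) has_real_derivative 0) (at s within {0..T})"
      using C1_in_time_inner_has_derivative[OF assms(4) V1L s gL] by simp
  qed simp
  then have "L2_inner D (u t) ?g = L2_inner D (u 0) ?g" using t T0 by metis
  also have "\<dots> = - L2_inner D (p t) (weak_div D (u 0))"
    using g(2)[OF uV[OF T0]] by (simp add: L2_inner_commute)
  \<comment> \<open>The initial divergence vanishes only almost everywhere, which suffices under the
    integral.\<close>
  also have "L2_inner D (p t) (weak_div D (u 0)) = 0"
    using L2_inner_cong_AE_right[OF pL weak_div_L2 L2_zero] uV[OF T0] V1H assms(6)
    by (auto simp: ae_eq_def L2_inner_zero_right)
  finally have "L2_inner D ?g (u t) = 0" by (simp add: L2_inner_commute)
  then have "L2_inner D (du t) (u t) = 0"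
    using assms(7)[OF t uV[OF t]] s_h_self_orthogonal[OF zero uV[OF t], of D V2h] by simp
  then show "((\<lambda>s. LINT x|dmeas D. (1/2) * (norm (u s x))\<^sup>2) has_real_derivative 0) (at t within {0..T})"
    using C1_in_time_energy_has_derivative[OF assms(4) V1L t]
    by (simp add: L2_inner_def power2_norm_eq_inner)
qed

end
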